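(* Let $X$ be a dendrite whose set of endpoints $E(X)$ is dense in $X$. Then $NC^*(X)$ is homeomorphic to the space of irrational numbers $\mathbb{R}\setminus\mathbb{Q}$.
   Context: A continuum is a compact connected metric space with more than one point; a subcontinuum of $X$ is a nonempty closed connected subset of $X$ (one-point sets are allowed). A dendroid is an arcwise connected, hereditarily unicoherent continuum; a dendrite is a locally connected dendroid. The order of a point $p$ in $X$ is the least cardinal $\kappa$ such that $p$ has arbitrarily small neighborhoods with boundary of cardinality $\leq\kappa$ (in a dendrite it equals the number of components of $X\setminus\{p\}$, being $\omega$ if this number is infinite); $E(X)$ is the set of points of order $1$. $C(X)$ is the set of all subcontinua of $X$, endowed with the Hausdorff metric (equivalently, the Vietoris topology), and $NC^*(X)=\{A\in C(X): X\setminus A \text{ is connected}\}$ with the subspace topology; the empty set counts as connected, so $X\in NC^*(X)$. *)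

theory Defs
  imports "HOL-Analysis.Analysis"
begin

text \<open>A metric continuum is rendered as a subset \<open>X\<close> of a metric space of arbitrary type, with the
  induced metric.\<close>

definition continuum :: "'a::metric_space set \<Rightarrow> bool" where
  "continuum X \<longleftrightarrow> compact X \<and> connected X \<and> (\<exists>x\<in>X. \<exists>y\<in>X. x \<noteq> y)"

definition subcontinua :: "'a::metric_space set \<Rightarrow> 'a set set" where
  "subcontinua X = {A. A \<noteq> {} \<and> closedin (top_of_set X) A \<and> connected A}"

definition arcwise_connected :: "'a::metric_space set \<Rightarrow> bool" where
  "arcwise_connected X \<longleftrightarrow>
    (\<forall>x\<in>X. \<forall>y\<in>X. x \<noteq> y \<longrightarrow>
      (\<exists>g. arc g \<and> path_image g \<subseteq> X \<and> pathstart g = x \<and> pathfinish g = y))"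

definition hereditarily_unicoherent :: "'a::metric_space set \<Rightarrow> bool" where
  "hereditarily_unicoherent X \<longleftrightarrow> (\<forall>Y \<in> subcontinua X. unicoherent Y)"

definition dendroid :: "'a::metric_space set \<Rightarrow> bool" where
  "dendroid X \<longleftrightarrow> continuum X \<and> arcwise_connected X \<and> hereditarily_unicoherent X"

definition dendrite :: "'a::metric_space set \<Rightarrow> bool" where
  "dendrite X \<longleftrightarrow> dendroid X \<and> locally_connected_space (top_of_set X)"

text \<open>Cardinals are represented by sets, compared by \<open>\<lesssim>\<close>. Sets over the type of the points
  suffice, as the boundaries in question are subsets of \<open>X\<close>. Neighbourhoods are taken open;
  this does not change the order, because the boundary of the interior of a neighbourhood is
  contained in the boundary of the neighbourhood.\<close>

definition order_at_most :: "'a::metric_space set \<Rightarrow> 'a \<Rightarrow> 'a set \<Rightarrow> bool" where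
  "order_at_most X p K \<longleftrightarrow>
    (\<forall>U. openin (top_of_set X) U \<and> p \<in> U \<longrightarrow>
      (\<exists>V. openin (top_of_set X) V \<and> p \<in> V \<and> V \<subseteq> U \<and> (top_of_set X) frontier_of V \<lesssim> K))"

definition has_order :: "'a::metric_space set \<Rightarrow> 'a \<Rightarrow> 'a set \<Rightarrow> bool" where
  "has_order X p K \<longleftrightarrow> order_at_most X p K \<and> (\<forall>L. order_at_most X p L \<longrightarrow> K \<lesssim> L)"

text \<open>The singleton \<open>{p}\<close> below stands for the cardinal 1.\<close>

definition endpoints :: "'a::metric_space set \<Rightarrow> 'a set" where
  "endpoints X = {p \<in> X. has_order X p {p}}"

text \<open>The value 0 outside the nonempty bounded sets is a convention only; all subcontinua of a
  continuum are nonempty and bounded.\<close>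

definition hausdorff_dist :: "'a::metric_space set \<Rightarrow> 'a set \<Rightarrow> real" where
  "hausdorff_dist A B =
    (if A \<noteq> {} \<and> B \<noteq> {} \<and> bounded A \<and> bounded B
     then max (SUP a\<in>A. infdist a B) (SUP b\<in>B. infdist b A) else 0)"

lemma bdd_above_infdist:
  assumes "bounded A" "B \<noteq> {}"
  shows "bdd_above ((\<lambda>a. infdist a B) ` A)"
proof -
  obtain b where b: "b \<in> B" using assms by blast
  obtain e where e: "\<And>a. a \<in> A \<Longrightarrow> dist b a \<le> e"
    using assms(1) by (metis bounded_any_center)
  show ?thesis
    by (rule bdd_aboveI2[where M = e]) (metis b dist_commute e infdist_le2)
qed

lemma infdist_le_hausdorff_dist:
  assumes "A \<noteq> {}" "B \<noteq> {}" "bounded A" "bounded B" "a \<in> A"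
  shows "infdist a B \<le> hausdorff_dist A B"
  using assms cSUP_upper[OF assms(5) bdd_above_infdist[OF assms(3,2)]]
  by (auto simp: hausdorff_dist_def)

lemma hausdorff_dist_commute: "hausdorff_dist A B = hausdorff_dist B A"
  by (auto simp: hausdorff_dist_def max.commute)

lemma hausdorff_dist_nonneg: "0 \<le> hausdorff_dist A B"
proof (cases "A \<noteq> {} \<and> B \<noteq> {} \<and> bounded A \<and> bounded B")
  case True
  then obtain a where "a \<in> A" by blast
  then show ?thesis
    using True infdist_le_hausdorff_dist[of A B a] infdist_nonneg[of a B] by linarith
qed (auto simp: hausdorff_dist_def)

lemma infdist_triangle_hausdorff_dist:
  assumes "A \<noteq> {}" "B \<noteq> {}" "C \<noteq> {}" "bounded A" "bounded B" "bounded C" "a \<in> A"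
  shows "infdist a C \<le> hausdorff_dist A B + hausdorff_dist B C"
proof -
  have "infdist a C - hausdorff_dist B C \<le> dist a b" if "b \<in> B" for b
    using infdist_triangle[of a C b] infdist_le_hausdorff_dist[of B C b] assms that by linarith
  then have "infdist a C - hausdorff_dist B C \<le> infdist a B"
    unfolding infdist_notempty[OF assms(2)] using assms(2) by (intro cINF_greatest)
  then show ?thesis
    using infdist_le_hausdorff_dist[of A B a] assms by linarith
qed

lemma Metric_space_hausdorff_dist:
  assumes "compact X"
  shows "Metric_space (subcontinua X) hausdorff_dist"
proof
  have props: "A \<noteq> {}" "bounded A" "closed A" if "A \<in> subcontinua X" for A
    using that assms closedin_compact[of X A]
    by (auto simp: subcontinua_def compact_imp_bounded compact_imp_closed)
  show "0 \<le> hausdorff_dist A B" for A B :: "'a set" by (rule hausdorff_dist_nonneg)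
  show "hausdorff_dist A B = hausdorff_dist B A" for A B :: "'a set"
    by (rule hausdorff_dist_commute)
  show "hausdorff_dist A B = 0 \<longleftrightarrow> A = B" if "A \<in> subcontinua X" "B \<in> subcontinua X" for A B
  proof
    assume 0: "hausdorff_dist A B = 0"
    have sub: "A \<subseteq> B"
      if "A \<in> subcontinua X" "B \<in> subcontinua X" "hausdorff_dist A B = 0" for A B
    proof
      fix a assume "a \<in> A"
      then have "infdist a B = 0"
        using infdist_le_hausdorff_dist[of A B a] infdist_nonneg[of a B] that(3)
          props[OF that(1)] props[OF that(2)] by linarith
      then show "a \<in> B"
        using in_closed_iff_infdist_zero[of B a] props[OF that(2)] by simp
    qed
    show "A = B" using sub that 0 by (metis hausdorff_dist_commute subset_antisym)
  next
    assume "A = B"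
    then show "hausdorff_dist A B = 0"
      using props[OF that(1)] by (simp add: hausdorff_dist_def)
  qed
  show "hausdorff_dist A C \<le> hausdorff_dist A B + hausdorff_dist B C"
    if "A \<in> subcontinua X" "B \<in> subcontinua X" "C \<in> subcontinua X" for A B C
  proof -
    note p = props[OF that(1)] props[OF that(2)] props[OF that(3)]
    have "(SUP a\<in>A. infdist a C) \<le> hausdorff_dist A B + hausdorff_dist B C"
      by (intro cSUP_least infdist_triangle_hausdorff_dist p)
    moreover have "(SUP c\<in>C. infdist c A) \<le> hausdorff_dist C B + hausdorff_dist B A"
      by (intro cSUP_least infdist_triangle_hausdorff_dist p)
    ultimately show ?thesis
      using p unfolding hausdorff_dist_def[of A C] hausdorff_dist_commute[of C B]
        hausdorff_dist_commute[of B A] by simp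
  qed
qed

definition hyperspace :: "'a::metric_space set \<Rightarrow> 'a set topology" where
  "hyperspace X = Metric_space.mtopology (subcontinua X) hausdorff_dist"

definition NC_star :: "'a::metric_space set \<Rightarrow> 'a set topology" where
  "NC_star X = subtopology (hyperspace X) {A \<in> subcontinua X. connected (X - A)}"

end

theory Submission
  imports Defs
begin

text \<open>
Both spaces are nonempty, separable, completely metrizable and zero-dimensional, and neither contains
a nonempty compact open set. By the theorem of Alexandroff and Urysohn any two such spaces are
homeomorphic: each of them can be split into infinitely many nonempty clopen sets of small diameter,
each piece can be split again, and so on; completeness makes every infinite branch of this tree
shrink to a point, so that matching the branches of the two trees matches the points. This is
\<open>Alexandroff_Urysohn\<close>; the work lies in checking its hypotheses for the space of subcontinua with
connected complement, called \<open>nonseparating\<close> below.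

The whole hyperspace \<open>C(X)\<close> is complete and second countable under the Hausdorff metric
(\<open>mcomplete_hausdorff_dist\<close>, \<open>second_countable_hyperspace\<close>). In a locally connected compactum
\<open>X - A\<close> is connected iff for each \<open>n\<close> some connected open \<open>G\<close> whose closure misses \<open>A\<close> swallows
all points at distance at least \<open>1/(n+1)\<close> from \<open>A\<close>. For fixed \<open>n\<close> this is an open condition on
\<open>A\<close>, so the nonseparating subcontinua form a \<open>G\<^sub>\<delta>\<close> set (\<open>gdelta_nonseparating\<close>).

The rest is governed by the branch points, those \<open>d\<close> for which \<open>X - {d}\<close> has at least three
components. As the endpoints are dense, a branch point separates any two disjoint subcontinua
(\<open>branch_point_between\<close>): an arc between them is met by a side branch leading to a nearby endpoint.
Consequently branch points are dense in every nondegenerate subcontinuum (\<open>branch_point_near\<close>), and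
a nonseparating \<open>A \<noteq> X\<close> has arbitrarily tight neighbourhoods which are components of \<open>X - {d}\<close>
for branch points \<open>d\<close> (\<open>branch_cut_near\<close>).

A nonseparating \<open>A\<close> contains the branch point \<open>d\<close> iff it meets two of three given components of
\<open>X - {d}\<close>. The latter condition is open and the former is closed, so \<open>{A. d \<in> A}\<close> is clopen, and so is
\<open>{A. A \<subseteq> V}\<close> for each component \<open>V\<close> of \<open>X - {d}\<close>. A finite net of branch points of \<open>A\<close>, together with a tight
\<open>V \<supseteq> A\<close>, determines a small clopen neighbourhood of \<open>A\<close> (\<open>zero_dimensional_NC_star\<close>).

Finally, if \<open>V\<close> is a component of \<open>X - {d}\<close> with \<open>d\<close> a branch point, the closure of \<open>V\<close> is a limit of
nonseparating subcontinua but separates \<open>X\<close> itself, since at least two components remain outside it.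
Such closures occur arbitrarily close to every nonseparating \<open>A \<noteq> X\<close>, and \<open>X\<close> itself is a limit of
proper nonseparating subcontinua. Hence no nonempty open set of nonseparating subcontinua is closed
in \<open>C(X)\<close>, so none is compact (\<open>not_compactin_open_NC_star\<close>).
\<close>

section \<open>Schemes indexed by finite sequences\<close>

text \<open>A tree of open sets, indexed by finite sequences with the most recent entry first, in which
\<open>F (n # s)\<close> is the \<open>n\<close>-th child of \<open>F s\<close>. The last two conditions say that infinite branches have
nonempty intersection and that the tree is a base; in a Hausdorff space the points thus correspond to
the infinite branches, as in the Baire space of sequences of natural numbers.\<close>

definition baire_scheme :: "'a topology \<Rightarrow> (nat list \<Rightarrow> 'a set) \<Rightarrow> bool" where
  "baire_scheme T F \<longleftrightarrow>
    F [] = topspace T \<and>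
    (\<forall>s. openin T (F s)) \<and>
    (\<forall>s. F s = (\<Union>n. F (n # s))) \<and>
    (\<forall>s. disjoint_family (\<lambda>n. F (n # s))) \<and>
    (\<forall>x. (\<Inter>k. F (rev (map x [0..<k]))) \<noteq> {}) \<and>
    (\<forall>U p. openin T U \<and> p \<in> U \<longrightarrow> (\<exists>s. p \<in> F s \<and> F s \<subseteq> U))"

lemma baire_scheme_Nil: "baire_scheme T F \<Longrightarrow> F [] = topspace T"
  unfolding baire_scheme_def by (elim conjE)

lemma baire_scheme_base:
  assumes "baire_scheme T F" "openin T U" "p \<in> U"
  obtains s where "p \<in> F s" "F s \<subseteq> U"
  using assms unfolding baire_scheme_def by metis

lemma baire_scheme_openin: "baire_scheme T F \<Longrightarrow> openin T (F s)"
  unfolding baire_scheme_def by metis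

lemma baire_scheme_address:
  assumes "baire_scheme T F" "p \<in> topspace T"
  obtains x where "\<And>k. p \<in> F (rev (map x [0..<k]))"
proof -
  have "\<exists>n. p \<in> F s \<longrightarrow> p \<in> F (n # s)" for s
    using assms(1) unfolding baire_scheme_def by (metis UN_E)
  then obtain g where g: "\<And>s. p \<in> F s \<Longrightarrow> p \<in> F (g s # s)" by metis
  define S where "S = rec_nat [] (\<lambda>_ s. g s # s)"
  define x where "x = (\<lambda>k. g (S k))"
  have S_eq: "S k = rev (map x [0..<k])" for k
    by (induction k) (auto simp: S_def x_def)
  have "p \<in> F (S k)" for k
    by (induction k) (use assms g baire_scheme_Nil in \<open>auto simp: S_def\<close>)
  then show thesis using that S_eq by metis
qed

lemma baire_scheme_unique:
  assumes F: "baire_scheme T F" and "length s = length t" "p \<in> F s" "p \<in> F t"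
  shows "s = t"
  using assms(2-)
proof (induction s t rule: list_induct2)
  case (Cons a s b t)
  have sub: "F (n # r) \<subseteq> F r" for n r
    using F unfolding baire_scheme_def by (metis UN_upper UNIV_I)
  have "s = t" using Cons sub by blast
  moreover have "disjoint_family (\<lambda>n. F (n # s))"
    using F unfolding baire_scheme_def by blast
  ultimately show ?case
    using Cons.prems unfolding disjoint_family_on_def by blast
qed simp

lemma baire_scheme_address_iff:
  assumes F: "baire_scheme T F" and x: "\<And>k. p \<in> F (rev (map x [0..<k]))"
  shows "p \<in> F s \<longleftrightarrow> s = rev (map x [0..<length s])"
proof
  assume "p \<in> F s"
  then show "s = rev (map x [0..<length s])"
    by (intro baire_scheme_unique[OF F _ _ x]) simp_all
next
  assume "s = rev (map x [0..<length s])"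
  then show "p \<in> F s" using x by metis
qed

text \<open>The points of a space with a scheme are its branches, so the point of the other space on the same
branch is the one wanted. Formulating this by membership in the sets of the scheme makes the matching
symmetric and avoids any mention of the sequence space.\<close>

lemma baire_scheme_partner:
  assumes F: "baire_scheme T F" and G: "baire_scheme T' G" and p: "p \<in> topspace T"
  shows "\<exists>q \<in> topspace T'. \<forall>s. q \<in> G s \<longleftrightarrow> p \<in> F s"
proof -
  obtain x where x: "\<And>k. p \<in> F (rev (map x [0..<k]))"
    using baire_scheme_address[OF F p] by blast
  obtain q where q: "\<And>k. q \<in> G (rev (map x [0..<k]))"
  proof -
    have "(\<Inter>k. G (rev (map x [0..<k]))) \<noteq> {}"
      using G unfolding baire_scheme_def by (elim conjE) (erule spec)
    then show thesis using that by auto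
  qed
  have "q \<in> G s \<longleftrightarrow> p \<in> F s" for s
    using baire_scheme_address_iff[OF F x] baire_scheme_address_iff[OF G q] by metis
  moreover have "q \<in> topspace T'"
    using q[of 0] baire_scheme_Nil[OF G] by simp
  ultimately show ?thesis by (intro bexI[of _ q]) simp_all
qed

lemma baire_scheme_separates:
  assumes "baire_scheme T F" "Hausdorff_space T" "p \<in> topspace T" "q \<in> topspace T"
    and "\<And>s. p \<in> F s \<longleftrightarrow> q \<in> F s"
  shows "p = q"
proof (rule ccontr)
  assume "p \<noteq> q"
  then obtain U where "openin T U" "p \<in> U" "q \<notin> U"
    using assms(2-4) unfolding Hausdorff_space_def by (metis disjnt_iff)
  then show False
    using baire_scheme_base[OF assms(1)] assms(5) by blast
qed

text \<open>The preimage of a member of the base is again the member of the base with the same index.\<close>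

lemma baire_scheme_continuous_map:
  assumes F: "baire_scheme T F" and G: "baire_scheme T' G"
    and f: "\<And>p. p \<in> topspace T \<Longrightarrow> f p \<in> topspace T'"
      "\<And>p s. p \<in> topspace T \<Longrightarrow> f p \<in> G s \<longleftrightarrow> p \<in> F s"
  shows "continuous_map T T' f"
  unfolding continuous_map
proof (intro conjI allI impI)
  show "f ` topspace T \<subseteq> topspace T'" using f by auto
  fix U assume U: "openin T' U"
  have sub: "F s \<subseteq> topspace T" for s
    using baire_scheme_openin[OF F] by (rule openin_subset)
  have "{p \<in> topspace T. f p \<in> U} = (\<Union>s \<in> {s. G s \<subseteq> U}. F s)" (is "?L = ?R")
  proof (intro equalityI subsetI)
    fix p assume "p \<in> ?L"
    then obtain s where "f p \<in> G s" "G s \<subseteq> U"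
      using baire_scheme_base[OF G U] by blast
    then show "p \<in> ?R" using \<open>p \<in> ?L\<close> f by auto
  next
    fix p assume "p \<in> ?R"
    then show "p \<in> ?L" using f sub by blast
  qed
  moreover have "openin T ?R"
    using baire_scheme_openin[OF F] by blast
  ultimately show "openin T {p \<in> topspace T. f p \<in> U}" by simp
qed

lemma baire_schemes_homeomorphic:
  assumes F: "baire_scheme T F" and G: "baire_scheme T' G"
    and H: "Hausdorff_space T" "Hausdorff_space T'"
  shows "T homeomorphic_space T'"
proof -
  obtain f where f: "\<And>p. p \<in> topspace T \<Longrightarrow> f p \<in> topspace T'"
      "\<And>p s. p \<in> topspace T \<Longrightarrow> f p \<in> G s \<longleftrightarrow> p \<in> F s"
    using baire_scheme_partner[OF F G] by metis
  obtain g where g: "\<And>q. q \<in> topspace T' \<Longrightarrow> g q \<in> topspace T"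
      "\<And>q s. q \<in> topspace T' \<Longrightarrow> g q \<in> F s \<longleftrightarrow> q \<in> G s"
    using baire_scheme_partner[OF G F] by metis
  have "g (f p) = p" if "p \<in> topspace T" for p
    using baire_scheme_separates[OF F H(1)] f g that by metis
  moreover have "f (g q) = q" if "q \<in> topspace T'" for q
    using baire_scheme_separates[OF G H(2)] f g that by metis
  ultimately have "homeomorphic_maps T T' f g"
    using baire_scheme_continuous_map[OF F G] baire_scheme_continuous_map[OF G F] f g
    unfolding homeomorphic_maps_def by auto
  then show ?thesis unfolding homeomorphic_space_def by blast
qed

section \<open>The Alexandroff--Urysohn theorem\<close>

definition zero_dimensional :: "'a topology \<Rightarrow> bool" where
  "zero_dimensional T \<longleftrightarrow>
    (\<forall>U p. openin T U \<and> p \<in> U \<longrightarrow> (\<exists>V. openin T V \<and> closedin T V \<and> p \<in> V \<and> V \<subseteq> U))"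

text \<open>An open cover without a finite subcover provides the infinitude of the pieces. Each point of \<open>U\<close> gets
a clopen neighbourhood inside a member of that cover and inside a member of \<open>\<V>\<close>; countably many
of these suffice, and they are made disjoint by subtracting the earlier ones. If only finitely
many differences were nonempty, finitely many members of the cover would cover \<open>U\<close>. The family \<open>\<V>\<close>
serves to bound the diameters of the pieces.\<close>

lemma noncompact_clopen_partition:
  assumes T: "zero_dimensional T" "second_countable T"
    and U: "openin T U" "closedin T U" "\<not> compactin T U"
    and \<V>: "\<And>V. V \<in> \<V> \<Longrightarrow> openin T V" "U \<subseteq> \<Union>\<V>"
  obtains W :: "nat \<Rightarrow> 'a set" where
    "\<And>n. openin T (W n)" "\<And>n. closedin T (W n)" "\<And>n. W n \<noteq> {}" "disjoint_family W"
    "(\<Union>n. W n) = U" "\<And>n. \<exists>V\<in>\<V>. W n \<subseteq> V"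
proof -
  have Usub: "U \<subseteq> topspace T" using U openin_subset by blast
  then obtain \<C> where \<C>: "\<And>C. C \<in> \<C> \<Longrightarrow> openin T C" "U \<subseteq> \<Union>\<C>"
    and nofin: "\<And>\<F>. finite \<F> \<Longrightarrow> \<F> \<subseteq> \<C> \<Longrightarrow> \<not> U \<subseteq> \<Union>\<F>"
    using U(3) unfolding compactin_def by metis
  have "\<exists>N. openin T N \<and> closedin T N \<and> p \<in> N \<and> N \<subseteq> U \<and> (\<exists>C\<in>\<C>. N \<subseteq> C) \<and> (\<exists>V\<in>\<V>. N \<subseteq> V)"
    if p: "p \<in> U" for p
  proof -
    obtain C V where CV: "C \<in> \<C>" "V \<in> \<V>" "p \<in> C" "p \<in> V"
      using p \<C>(2) \<V>(2) by (meson UnionE subsetD)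
    then have "openin T (U \<inter> C \<inter> V)" using U \<C> \<V> by blast
    moreover have "p \<in> U \<inter> C \<inter> V" using CV p by blast
    ultimately obtain N where "openin T N" "closedin T N" "p \<in> N" "N \<subseteq> U \<inter> C \<inter> V"
      using T(1) unfolding zero_dimensional_def by meson
    then show ?thesis using CV by (intro exI[of _ N]) blast
  qed
  then obtain N where N: "\<And>p. p \<in> U \<Longrightarrow> openin T (N p) \<and> closedin T (N p) \<and> p \<in> N p \<and> N p \<subseteq> U
      \<and> (\<exists>C\<in>\<C>. N p \<subseteq> C) \<and> (\<exists>V\<in>\<V>. N p \<subseteq> V)" by metis
  have "Lindelof_space (subtopology T U)"
    using T(2) by (simp add: second_countable_imp_Lindelof_space second_countable_subtopology)
  then have "\<exists>\<K>. countable \<K> \<and> \<K> \<subseteq> N ` U \<and> U \<subseteq> \<Union>\<K>"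
    using N unfolding Lindelof_space_subtopology_subset[OF Usub]
    by (smt (verit, best) UN_I image_iff subset_eq)
  then obtain \<K> where \<K>: "countable \<K>" "\<K> \<subseteq> N ` U" "U \<subseteq> \<Union>\<K>" by blast
  have "\<K> \<noteq> {}" using nofin[of "{}"] \<K> by auto
  define K where "K = from_nat_into \<K>"
  have rK: "range K = \<K>" unfolding K_def using \<K>(1) \<open>\<K> \<noteq> {}\<close> by (rule range_from_nat_into[rotated])
  have K: "openin T (K n)" "closedin T (K n)" "K n \<subseteq> U" "\<exists>C\<in>\<C>. K n \<subseteq> C" "\<exists>V\<in>\<V>. K n \<subseteq> V" for n
  proof -
    have "K n \<in> N ` U" using rK \<K>(2) by auto
    then obtain p where "p \<in> U" "K n = N p" by blast
    then show "openin T (K n)" "closedin T (K n)" "K n \<subseteq> U" "\<exists>C\<in>\<C>. K n \<subseteq> C" "\<exists>V\<in>\<V>. K n \<subseteq> V"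
      using N[of p] by simp_all
  qed
  have UK: "(\<Union>n. K n) = U" using K(3) \<K>(3) rK by auto
  define D where "D = disjointed K"
  have UD: "(\<Union>n. D n) = U" using UK UN_disjointed_eq[of K] by (simp add: D_def)
  have Do: "openin T (D n)" "closedin T (D n)" for n
    unfolding D_def disjointed_def using K(1,2)
    by (auto intro!: openin_diff closedin_diff closedin_Union openin_Union)
  have DK: "D n \<subseteq> K n" for n by (auto simp: D_def disjointed_def)
  \<comment> \<open>Empty differences have to be skipped: \<open>J\<close> is infinite, and its enumeration numbers the pieces.\<close>
  define J where "J = {n. D n \<noteq> {}}"
  have "infinite J"
  proof
    assume "finite J"
    obtain c where c: "\<And>n. c n \<in> \<C> \<and> K n \<subseteq> c n" using K(4) by metis
    have "U \<subseteq> \<Union>(c ` J)" using UD DK c unfolding J_def by blast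
    then show False using nofin[of "c ` J"] \<open>finite J\<close> c by blast
  qed
  show thesis
  proof (rule that[of "\<lambda>n. D (enumerate J n)"])
    show "disjoint_family (\<lambda>n. D (enumerate J n))"
      using disjoint_family_disjointed[of K] strict_mono_enumerate[OF \<open>infinite J\<close>]
      unfolding disjoint_family_on_def D_def by (simp add: strict_mono_eq)
    show "D (enumerate J n) \<noteq> {}" for n
      using enumerate_in_set[OF \<open>infinite J\<close>, of n] by (simp add: J_def)
    have "(\<Union>n. D (enumerate J n)) = (\<Union>n\<in>J. D n)"
      using range_enumerate[OF \<open>infinite J\<close>] by (metis image_image)
    also have "\<dots> = U" using UD by (auto simp: J_def)
    finally show "(\<Union>n. D (enumerate J n)) = U" .
    show "\<exists>V\<in>\<V>. D (enumerate J n) \<subseteq> V" for n using K(5) DK by (meson subset_trans)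
  qed (use Do in auto)
qed

text \<open>The pieces at level \<open>k + 1\<close> lie in balls of radius \<open>1/(k+1)\<close>. This makes the tree a base,
and Cantor's intersection theorem makes every branch converge.\<close>

lemma baire_scheme_exists:
  assumes T: "completely_metrizable_space T" "second_countable T" "zero_dimensional T"
    and ne: "topspace T \<noteq> {}"
    and nc: "\<And>U. openin T U \<Longrightarrow> U \<noteq> {} \<Longrightarrow> \<not> compactin T U"
  shows "\<exists>F. baire_scheme T F"
proof -
  obtain M d where Md: "Metric_space M d" "Metric_space.mcomplete M d" "T = Metric_space.mtopology M d"
    using T(1) unfolding completely_metrizable_space_def by blast
  interpret Metric_space M d by (rule Md(1))
  note T_eq = Md(3)
  define splits where "splits U k W \<longleftrightarrow>
      (\<forall>n. openin T (W n) \<and> closedin T (W n) \<and> W n \<noteq> {} \<and> (\<exists>a. W n \<subseteq> mball a (1 / Suc k)))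
      \<and> disjoint_family W \<and> (\<Union>n. W n) = U" for U and k :: nat and W :: "nat \<Rightarrow> 'a set"
  have "\<exists>W. splits U k W" if U: "openin T U" "closedin T U" "U \<noteq> {}" for U k
  proof -
    let ?V = "(\<lambda>a. mball a (1 / Suc k)) ` M"
    have "U \<subseteq> \<Union>?V" using openin_subset[OF U(1)] by (force simp: T_eq)
    moreover have "openin T V" if "V \<in> ?V" for V using that by (auto simp: T_eq)
    ultimately obtain W :: "nat \<Rightarrow> 'a set" where W: "\<And>n. openin T (W n)" "\<And>n. closedin T (W n)"
      "\<And>n. W n \<noteq> {}" "disjoint_family W" "(\<Union>n. W n) = U" "\<And>n. \<exists>V\<in>?V. W n \<subseteq> V"
      using noncompact_clopen_partition[OF T(3,2) U(1,2) nc[OF U(1,3)], of ?V] by metis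
    then show ?thesis unfolding splits_def by (intro exI[of _ W]) blast
  qed
  then obtain Q where Q: "\<And>U k. openin T U \<Longrightarrow> closedin T U \<Longrightarrow> U \<noteq> {} \<Longrightarrow> splits U k (Q U k)"
    by metis
  define F where "F = rec_list (topspace T) (\<lambda>n s R. Q R (length s) n)"
  have F0: "F [] = topspace T" and FS: "F (n # s) = Q (F s) (length s) n" for n s
    by (simp_all add: F_def)
  have inv: "openin T (F s) \<and> closedin T (F s) \<and> F s \<noteq> {}" for s
  proof (induction s)
    case (Cons n s)
    then have "splits (F s) (length s) (Q (F s) (length s))" using Q by blast
    then show ?case unfolding FS splits_def by blast
  qed (use ne in \<open>simp add: F0\<close>)
  have "splits (F s) (length s) (\<lambda>n. F (n # s))" for s
    using Q[of "F s" "length s"] inv[of s] unfolding FS by blast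
  then have P: "\<And>s n. \<exists>a. F (n # s) \<subseteq> mball a (1 / Suc (length s))"
      "\<And>s. disjoint_family (\<lambda>n. F (n # s))" "\<And>s. (\<Union>n. F (n # s)) = F s"
    unfolding splits_def by blast+
  have sub: "F (n # s) \<subseteq> F s" for n s using P(3)[of s] by blast
  have level: "\<exists>s. p \<in> F s \<and> length s = k" if "p \<in> topspace T" for p k
  proof (induction k)
    case (Suc k)
    then obtain s where s: "p \<in> F s" "length s = k" by blast
    then obtain n where "p \<in> F (n # s)" using P(3)[of s] by blast
    then show ?case using s by (metis length_Cons)
  qed (use that in \<open>simp add: F0\<close>)
  have base: "\<exists>s. p \<in> F s \<and> F s \<subseteq> U" if "openin T U" "p \<in> U" for U p
  proof -
    obtain r where r: "r > 0" "mball p r \<subseteq> U" and pM: "p \<in> M"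
      using \<open>openin T U\<close> \<open>p \<in> U\<close> unfolding T_eq openin_mtopology by blast
    obtain k where k: "1 / real (Suc k) < r / 2"
      using r(1) by (meson half_gt_zero nat_approx_posE)
    obtain s where s: "p \<in> F s" "length s = Suc k"
      using level[of p "Suc k"] pM T_eq by auto
    then obtain n s' where s': "s = n # s'" "length s' = k" by (cases s) auto
    obtain a where a: "F s \<subseteq> mball a (1 / Suc k)" using P(1)[of n s'] s' by blast
    have "F s \<subseteq> mball p r"
    proof
      fix q assume "q \<in> F s"
      then have "q \<in> mball a (1 / Suc k)" "p \<in> mball a (1 / Suc k)" using a s by auto
      then have "d p q < r" using triangle[of p a q] commute[of p a] k by auto
      then show "q \<in> mball p r" using \<open>q \<in> mball a (1 / Suc k)\<close> pM by auto
    qed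
    then show ?thesis using s r by blast
  qed
  have branch: "(\<Inter>k. F (rev (map x [0..<k]))) \<noteq> {}" for x
  proof -
    define C where "C = (\<lambda>k. F (rev (map x [0..<k])))"
    have dec: "C (Suc k) \<subseteq> C k" for k using sub by (simp add: C_def)
    have "\<exists>n a. C n \<subseteq> mcball a \<epsilon>" if \<epsilon>: "\<epsilon> > 0" for \<epsilon>
    proof -
      obtain k where k: "1 / real (Suc k) < \<epsilon>" using nat_approx_posE[OF \<epsilon>] by blast
      obtain a where "C (Suc k) \<subseteq> mball a (1 / Suc k)"
        using P(1)[of "x k" "rev (map x [0..<k])"] by (auto simp: C_def)
      then have "C (Suc k) \<subseteq> mcball a \<epsilon>" using k by (fastforce simp: subset_iff)
      then show ?thesis by blast
    qed
    moreover have "\<forall>n. closedin mtopology (C n)" "\<forall>n. C n \<noteq> {}" "decseq C"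
      using inv dec unfolding T_eq by (auto simp: C_def decseq_Suc_iff)
    ultimately have "\<Inter>(range C) \<noteq> {}"
      using Md(2) unfolding mcomplete_nest by blast
    then show ?thesis by (simp add: C_def)
  qed
  have "baire_scheme T F"
    unfolding baire_scheme_def
  proof (intro conjI allI impI)
    show "F s = (\<Union>n. F (n # s))" for s by (rule P(3)[symmetric])
    show "\<exists>s. p \<in> F s \<and> F s \<subseteq> U" if "openin T U \<and> p \<in> U" for U p
      using base that by simp
  qed (fact F0 P(2) branch | simp only: inv)+
  then show ?thesis by blast
qed

text \<open>Any two spaces of this kind carry a scheme, and schemes with the same index set match up.\<close>

theorem Alexandroff_Urysohn:
  assumes "completely_metrizable_space T" "second_countable T" "zero_dimensional T"
    and "topspace T \<noteq> {}" "\<And>U. openin T U \<Longrightarrow> U \<noteq> {} \<Longrightarrow> \<not> compactin T U"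
    and "completely_metrizable_space T'" "second_countable T'" "zero_dimensional T'"
    and "topspace T' \<noteq> {}" "\<And>U. openin T' U \<Longrightarrow> U \<noteq> {} \<Longrightarrow> \<not> compactin T' U"
  shows "T homeomorphic_space T'"
proof -
  obtain F G where "baire_scheme T F" "baire_scheme T' G"
    using baire_scheme_exists[of T] baire_scheme_exists[of T'] assms by blast
  then show ?thesis
    using baire_schemes_homeomorphic assms(1,6)
    by (metis completely_metrizable_imp_metrizable_space metrizable_imp_Hausdorff_space)
qed

section \<open>The space of irrational numbers\<close>

abbreviation irrationals :: "real topology" where
  "irrationals \<equiv> top_of_set (UNIV - \<rat>)"

lemma irrational_between:
  fixes a b :: real
  assumes "a < b"
  obtains c where "c \<notin> \<rat>" "a < c" "c < b"
proof -
  have "\<not> {a<..<b} \<subseteq> \<rat>"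
    using assms uncountable_open_interval[of a b] countable_rat countable_subset by blast
  then obtain c where "c \<in> {a<..<b}" "c \<notin> \<rat>" by blast
  then show thesis using that by auto
qed

lemma completely_metrizable_irrationals: "completely_metrizable_space irrationals"
proof -
  have "UNIV - \<rat> = (\<Inter>q\<in>\<rat>. UNIV - {q::real})" by auto
  moreover have "gdelta_in euclideanreal (\<Inter>q\<in>\<rat>. UNIV - {q::real})"
    by (rule gdelta_in_Inter) (auto simp: countable_rat intro!: open_imp_gdelta_in)
  ultimately show ?thesis
    by (simp add: completely_metrizable_space_gdelta_in completely_metrizable_space_euclidean)
qed

lemma second_countable_irrationals: "second_countable irrationals"
proof -
  obtain \<B> :: "real set set" where "countable \<B>" "\<And>U. U \<in> \<B> \<Longrightarrow> open U"
      "\<And>U. open U \<Longrightarrow> \<exists>\<B>'\<subseteq>\<B>. U = \<Union>\<B>'"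
    using ex_countable_basis by (metis topological_basis_def)
  then have "second_countable euclideanreal"
    unfolding second_countable_def by (intro exI[of _ \<B>]) (simp, metis UnionE Union_upper subsetD)
  then show ?thesis by (rule second_countable_subtopology)
qed

lemma zero_dimensional_irrationals: "zero_dimensional irrationals"
  unfolding zero_dimensional_def
proof (intro allI impI, elim conjE)
  fix U and p :: real assume U: "openin irrationals U" "p \<in> U"
  then have p: "p \<notin> \<rat>" using openin_subset by fastforce
  obtain e where e: "e > 0" "ball p e \<inter> (UNIV - \<rat>) \<subseteq> U"
    using U openin_contains_ball by metis
  obtain a where a: "a \<in> \<rat>" "p - e < a" "a < p" using Rats_dense_in_real[of "p - e" p] e by auto
  obtain b where b: "b \<in> \<rat>" "p < b" "b < p + e" using Rats_dense_in_real[of p "p + e"] e by auto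
  let ?V = "{a<..<b} \<inter> (UNIV - \<rat>)"
  have "?V = {a..b} \<inter> (UNIV - \<rat>)" using a b by (auto simp: less_le)
  then have "closedin irrationals ?V"
    by (metis Int_commute closed_atLeastAtMost closedin_closed_Int)
  moreover have "openin irrationals ?V" by (metis Int_commute open_greaterThanLessThan openin_open_Int)
  moreover have "?V \<subseteq> U" using e a b by (auto simp: dist_real_def subset_iff)
  ultimately show "\<exists>V. openin irrationals V \<and> closedin irrationals V \<and> p \<in> V \<and> V \<subseteq> U"
    using a b p by (intro exI[of _ ?V]) auto
qed

text \<open>A compact set is closed in the line, but a nonempty open set of irrationals has rational limit points.\<close>

lemma not_compactin_open_irrationals:
  assumes "openin irrationals U" "U \<noteq> {}"
  shows "\<not> compactin irrationals U"
proof
  assume "compactin irrationals U"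
  then have "compact U" by (simp add: compactin_subtopology)
  obtain p where "p \<in> U" using assms by blast
  then obtain e where e: "e > 0" "ball p e \<inter> (UNIV - \<rat>) \<subseteq> U"
    using assms openin_contains_ball by metis
  obtain q where q: "q \<in> \<rat>" "p < q" "q < p + e" using Rats_dense_in_real[of p "p + e"] e by auto
  have "q \<in> closure U"
    unfolding closure_approachable
  proof (intro allI impI)
    fix r :: real assume "r > 0"
    obtain c where c: "c \<notin> \<rat>" "q < c" "c < min (p + e) (q + r)"
      by (rule irrational_between[of q "min (p + e) (q + r)"]) (use q \<open>r > 0\<close> in auto)
    then have "c \<in> U" using e q by (auto simp: dist_real_def subset_iff)
    then show "\<exists>y\<in>U. dist y q < r" using c by (intro bexI[of _ c]) (auto simp: dist_real_def)
  qed
  then have "q \<in> U" using \<open>compact U\<close> by (simp add: compact_imp_closed)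
  then show False using q assms openin_subset by fastforce
qed

section \<open>The hyperspace of subcontinua\<close>

lemma subcontinuaD:
  assumes "compact X" "A \<in> subcontinua X"
  shows "A \<noteq> {}" "A \<subseteq> X" "compact A" "closed A" "bounded A" "connected A"
  using assms closedin_compact[of X A]
  by (auto simp: subcontinua_def compact_imp_bounded compact_imp_closed dest: closedin_imp_subset)

lemma subcontinuaI:
  assumes "A \<noteq> {}" "A \<subseteq> X" "closed A" "connected A"
  shows "A \<in> subcontinua X"
  using assms by (auto simp: subcontinua_def closed_subset)

lemma hausdorff_dist_le:
  assumes "A \<noteq> {}" "B \<noteq> {}" "bounded A" "bounded B"
    and "\<And>a. a \<in> A \<Longrightarrow> \<exists>b\<in>B. dist a b \<le> e" "\<And>b. b \<in> B \<Longrightarrow> \<exists>a\<in>A. dist a b \<le> e"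
  shows "hausdorff_dist A B \<le> e"
proof -
  have "(SUP a\<in>A. infdist a B) \<le> e"
    using assms(1,5) by (intro cSUP_least) (auto intro: infdist_le2)
  moreover have "(SUP b\<in>B. infdist b A) \<le> e"
    using assms(2,6) by (intro cSUP_least) (auto intro: infdist_le2 simp: dist_commute)
  ultimately show ?thesis using assms(1-4) by (simp add: hausdorff_dist_def)
qed

lemma infdist_less_obtain:
  assumes "infdist a B < e" "B \<noteq> {}"
  obtains b where "b \<in> B" "dist a b < e"
proof (rule ccontr)
  assume "\<not> thesis"
  then have "e \<le> dist a b" if "b \<in> B" for b
    using \<open>b \<in> B\<close> \<open>\<And>b. b \<in> B \<Longrightarrow> dist a b < e \<Longrightarrow> thesis\<close> by force
  then have "e \<le> infdist a B"
    unfolding infdist_notempty[OF assms(2)] using assms(2) by (intro cINF_greatest)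
  then show False using assms(1) by simp
qed

lemma hausdorff_dist_lessD:
  assumes "compact X" "A \<in> subcontinua X" "B \<in> subcontinua X" "hausdorff_dist A B < e" "a \<in> A"
  obtains b where "b \<in> B" "dist a b < e"
proof -
  note p = subcontinuaD[OF assms(1,2)] subcontinuaD[OF assms(1,3)]
  have "infdist a B < e"
    using infdist_le_hausdorff_dist[OF p(1,7,5,11) assms(5)] assms(4) by simp
  then show thesis using infdist_less_obtain p(7) that by blast
qed

lemma topspace_hyperspace:
  assumes "compact X"
  shows "topspace (hyperspace X) = subcontinua X"
  using Metric_space.topspace_mtopology[OF Metric_space_hausdorff_dist[OF assms]]
  by (simp add: hyperspace_def)

lemma openin_hyperspace_iff:
  assumes "compact X"
  shows "openin (hyperspace X) \<U> \<longleftrightarrow> \<U> \<subseteq> subcontinua X \<and>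
    (\<forall>A\<in>\<U>. \<exists>e>0. \<forall>B\<in>subcontinua X. hausdorff_dist A B < e \<longrightarrow> B \<in> \<U>)"
proof -
  interpret Metric_space "subcontinua X" hausdorff_dist
    by (rule Metric_space_hausdorff_dist[OF assms])
  show ?thesis unfolding hyperspace_def openin_mtopology by (fastforce simp: subset_iff)
qed

lemma openin_hyperspaceD:
  assumes "compact X" "openin (hyperspace X) \<U>" "A \<in> \<U>"
  obtains e where "e > 0" "\<And>B. B \<in> subcontinua X \<Longrightarrow> hausdorff_dist A B < e \<Longrightarrow> B \<in> \<U>"
proof -
  have "\<forall>A\<in>\<U>. \<exists>e>0. \<forall>B\<in>subcontinua X. hausdorff_dist A B < e \<longrightarrow> B \<in> \<U>"
    using assms(2) unfolding openin_hyperspace_iff[OF assms(1)] by (rule conjunct2)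
  then show thesis using assms(3) that by metis
qed

text \<open>The distance to \<open>C\<close> attains a minimum on \<open>K\<close>, which is positive. Closed bounded subsets of the
ambient space need not be compact, so the argument relies on compactness of \<open>K\<close> alone.\<close>

lemma compact_closed_gap:
  fixes K C :: "'a::metric_space set"
  assumes "compact K" "closed C" "K \<inter> C = {}"
  obtains d where "d > 0" "\<And>x y. x \<in> K \<Longrightarrow> y \<in> C \<Longrightarrow> d \<le> dist x y"
proof (cases "K = {} \<or> C = {}")
  case True
  then show thesis using that[of 1] by auto
next
  case False
  obtain z where z: "z \<in> K" "\<And>x. x \<in> K \<Longrightarrow> infdist z C \<le> infdist x C"
    using continuous_attains_inf[OF assms(1) _ continuous_on_infdist[OF continuous_on_id], of C] False
    by auto
  have "infdist z C > 0"
    using z(1) False assms(2,3) in_closed_iff_infdist_zero[of C z] infdist_nonneg[of z C]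
    by (metis disjoint_iff order_le_less)
  moreover have "infdist z C \<le> dist x y" if "x \<in> K" "y \<in> C" for x y
    using z(2)[OF that(1)] infdist_le[OF that(2), of x] by simp
  ultimately show thesis using that by blast
qed

lemma openin_hyperspace_subset:
  assumes "compact X" "openin (top_of_set X) U"
  shows "openin (hyperspace X) {A \<in> subcontinua X. A \<subseteq> U}"
  unfolding openin_hyperspace_iff[OF assms(1)]
proof (intro conjI ballI)
  fix A assume "A \<in> {A \<in> subcontinua X. A \<subseteq> U}"
  then have A: "A \<in> subcontinua X" "A \<subseteq> U" by auto
  have "compact (X - U)"
    using assms closedin_compact[of X "X - U"] by (simp add: openin_closedin_eq)
  moreover have "A \<inter> (X - U) = {}" using A(2) by blast
  ultimately obtain d where d: "d > 0" "\<And>x y. x \<in> A \<Longrightarrow> y \<in> X - U \<Longrightarrow> d \<le> dist x y"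
    using compact_closed_gap[OF subcontinuaD(3)[OF assms(1) A(1)] compact_imp_closed] by metis
  have "B \<subseteq> U" if B: "B \<in> subcontinua X" "hausdorff_dist A B < d" for B
  proof
    fix b assume b: "b \<in> B"
    then obtain a where "a \<in> A" "dist b a < d"
      using hausdorff_dist_lessD[OF assms(1) B(1) A(1)] B(2) by (metis hausdorff_dist_commute)
    then show "b \<in> U"
      using d(2)[of a b] b subcontinuaD(2)[OF assms(1) B(1)] by (force simp: dist_commute)
  qed
  then show "\<exists>e>0. \<forall>B\<in>subcontinua X. hausdorff_dist A B < e \<longrightarrow> B \<in> {A \<in> subcontinua X. A \<subseteq> U}"
    using d(1) by blast
qed auto

lemma openin_hyperspace_hits:
  assumes "compact X" "openin (top_of_set X) U"
  shows "openin (hyperspace X) {A \<in> subcontinua X. A \<inter> U \<noteq> {}}"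
  unfolding openin_hyperspace_iff[OF assms(1)]
proof (intro conjI ballI)
  fix A assume "A \<in> {A \<in> subcontinua X. A \<inter> U \<noteq> {}}"
  then obtain a where A: "A \<in> subcontinua X" "a \<in> A" "a \<in> U" by auto
  then obtain e where e: "e > 0" "ball a e \<inter> X \<subseteq> U"
    using assms(2) by (meson openin_contains_ball)
  have "B \<inter> U \<noteq> {}" if B: "B \<in> subcontinua X" "hausdorff_dist A B < e" for B
  proof -
    obtain b where "b \<in> B" "dist a b < e"
      using hausdorff_dist_lessD[OF assms(1) A(1) B(1) B(2) A(2)] by blast
    then show ?thesis using e(2) subcontinuaD(2)[OF assms(1) B(1)] by auto
  qed
  then show "\<exists>e>0. \<forall>B\<in>subcontinua X. hausdorff_dist A B < e \<longrightarrow> B \<in> {A \<in> subcontinua X. A \<inter> U \<noteq> {}}"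
    using e(1) by blast
qed auto

text \<open>If \<open>L\<close> split into two closed parts at distance \<open>d\<close>, a connected set within \<open>d/2\<close> of \<open>L\<close> would be split
by the \<open>d/2\<close>-neighbourhoods of the two parts.\<close>

lemma connected_hausdorff_limit:
  assumes "compact L"
    and approx: "\<And>e. e > 0 \<Longrightarrow> \<exists>C. connected C \<and> (\<forall>x\<in>L. \<exists>y\<in>C. dist x y < e) \<and> (\<forall>y\<in>C. \<exists>x\<in>L. dist x y < e)"
  shows "connected L"
proof (rule ccontr)
  assume "\<not> connected L"
  then obtain P Q where PQ: "closed P" "closed Q" "L \<subseteq> P \<union> Q" "P \<inter> Q \<inter> L = {}" "P \<inter> L \<noteq> {}" "Q \<inter> L \<noteq> {}"
    unfolding connected_closed by blast
  have "compact (P \<inter> L)" "closed (Q \<inter> L)"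
    using assms(1) PQ by (auto simp: compact_Int_closed closed_Int compact_imp_closed Int_commute)
  moreover have "(P \<inter> L) \<inter> (Q \<inter> L) = {}" using PQ(4) by blast
  ultimately obtain d where d: "d > 0" "\<And>x y. x \<in> P \<inter> L \<Longrightarrow> y \<in> Q \<inter> L \<Longrightarrow> d \<le> dist x y"
    using compact_closed_gap[of "P \<inter> L" "Q \<inter> L"] by metis
  obtain C where C: "connected C" "\<And>x. x \<in> L \<Longrightarrow> \<exists>y\<in>C. dist x y < d/2" "\<And>y. y \<in> C \<Longrightarrow> \<exists>x\<in>L. dist x y < d/2"
    using approx[of "d/2"] d(1) by auto
  let ?U = "\<Union>p\<in>P \<inter> L. ball p (d/2)" and ?V = "\<Union>q\<in>Q \<inter> L. ball q (d/2)"
  have disj: "?U \<inter> ?V = {}"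
  proof (rule ccontr)
    assume "?U \<inter> ?V \<noteq> {}"
    then obtain z p q where "p \<in> P \<inter> L" "q \<in> Q \<inter> L" "z \<in> ball p (d/2)" "z \<in> ball q (d/2)" by blast
    then have "p \<in> P \<inter> L" "q \<in> Q \<inter> L" "dist p z < d/2" "dist q z < d/2" by simp_all
    then show False using d(2)[of p q] dist_triangle2[of p q z] by linarith
  qed
  have cover: "C \<subseteq> ?U \<union> ?V"
  proof
    fix y assume "y \<in> C"
    then obtain x where "x \<in> L" "dist x y < d/2" using C(3) by blast
    then show "y \<in> ?U \<union> ?V" using PQ(3) by auto
  qed
  have "(\<Union>r\<in>R \<inter> L. ball r (d/2)) \<inter> C \<noteq> {}" if "R \<inter> L \<noteq> {}" for R
  proof -
    obtain r where r: "r \<in> R \<inter> L" using \<open>R \<inter> L \<noteq> {}\<close> by blast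
    then obtain y where "y \<in> C" "dist r y < d/2" using C(2) by blast
    then have "y \<in> ball r (d/2)" by simp
    then show ?thesis using r \<open>y \<in> C\<close> by blast
  qed
  then have "?U \<inter> C \<noteq> {}" "?V \<inter> C \<noteq> {}" using PQ(5,6) by blast+
  moreover have "open ?U" "open ?V" by auto
  moreover have "?U \<inter> ?V \<inter> C = {}" using disj by simp
  ultimately show False using connectedD[OF C(1) \<open>open ?U\<close> \<open>open ?V\<close> _ cover] by simp
qed

text \<open>The limit of a Cauchy sequence consists of the points whose distance to the members tends to
zero. Compactness of \<open>X\<close> provides such points near every point of a late member; connectedness
passes to the limit by \<open>connected_hausdorff_limit\<close>.\<close>

lemma mcomplete_hausdorff_dist:
  assumes X: "compact X"
  shows "Metric_space.mcomplete (subcontinua X) hausdorff_dist"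
proof -
  interpret Metric_space "subcontinua X" hausdorff_dist
    by (rule Metric_space_hausdorff_dist[OF X])
  show ?thesis
    unfolding mcomplete_def
  proof (intro allI impI)
    fix \<sigma> :: "nat \<Rightarrow> 'a set" assume \<sigma>: "MCauchy \<sigma>"
    then have S: "\<And>n. \<sigma> n \<in> subcontinua X"
      and cau: "\<And>e. e > 0 \<Longrightarrow> \<exists>N. \<forall>n n'. N \<le> n \<longrightarrow> N \<le> n' \<longrightarrow> hausdorff_dist (\<sigma> n) (\<sigma> n') < e"
      unfolding MCauchy_def by auto
    define L where "L = {x\<in>X. \<forall>e>0. \<exists>N. \<forall>n\<ge>N. \<exists>y\<in>\<sigma> n. dist x y < e}"
    have Ld: "\<exists>N. \<forall>n\<ge>N. \<exists>y\<in>\<sigma> n. dist x y < e" if "x \<in> L" "e > 0" for x e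
      using that by (simp add: L_def)
    have near: "\<exists>N. \<forall>n\<ge>N. (\<forall>x\<in>L. \<exists>y\<in>\<sigma> n. dist x y < e) \<and> (\<forall>y\<in>\<sigma> n. \<exists>x\<in>L. dist x y < e)"
      if e: "e > 0" for e
    proof -
      obtain N where N: "\<And>n m. N \<le> n \<Longrightarrow> N \<le> m \<Longrightarrow> hausdorff_dist (\<sigma> n) (\<sigma> m) < e/2"
        using cau[of "e/2"] e by auto
      have "\<exists>y\<in>\<sigma> n. dist x y < e" if "x \<in> L" "n \<ge> N" for x n
      proof -
        obtain M where M: "\<And>m. m \<ge> M \<Longrightarrow> \<exists>z\<in>\<sigma> m. dist x z < e/2"
          using Ld[OF \<open>x \<in> L\<close>, of "e/2"] e by auto
        obtain z where z: "z \<in> \<sigma> (max N M)" "dist x z < e/2" using M[of "max N M"] by auto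
        obtain y where "y \<in> \<sigma> n" "dist z y < e/2"
          using hausdorff_dist_lessD[OF X S S N[of "max N M" n] z(1)] \<open>n \<ge> N\<close> by auto
        then show ?thesis
          using z(2) dist_triangle[of x y z] by (intro bexI[of _ y]) auto
      qed
      moreover have "\<exists>x\<in>L. dist x y < e" if "y \<in> \<sigma> n" "n \<ge> N" for y n
      proof -
        \<comment> \<open>A point of the limit near \<open>y\<close> is obtained by following \<open>y\<close> through the later members and passing to a
          convergent subsequence.\<close>
        have "\<exists>z. z \<in> \<sigma> m \<and> dist y z < e/2" if "m \<ge> N" for m
          using hausdorff_dist_lessD[OF X S S N[of n m] \<open>y \<in> \<sigma> n\<close>] \<open>n \<ge> N\<close> \<open>m \<ge> N\<close> by metis
        then have "\<exists>z. z \<in> \<sigma> (N + m) \<and> dist y z < e/2" for m by simp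
        then obtain z where z: "\<And>m. z m \<in> \<sigma> (N + m)" "\<And>m. dist y (z m) < e/2" by metis
        have "z m \<in> X" for m using z(1) subcontinuaD(2)[OF X S] by blast
        then obtain x r where x: "x \<in> X" and r: "strict_mono (r::nat\<Rightarrow>nat)" and lim: "(z \<circ> r) \<longlonglongrightarrow> x"
          using X unfolding compact_def by metis
        have "x \<in> L"
          unfolding L_def
        proof (intro CollectI conjI allI impI)
          fix \<epsilon> :: real assume \<epsilon>: "\<epsilon> > 0"
          obtain M where M: "\<And>n m. M \<le> n \<Longrightarrow> M \<le> m \<Longrightarrow> hausdorff_dist (\<sigma> n) (\<sigma> m) < \<epsilon>/2"
            using cau[of "\<epsilon>/2"] \<epsilon> by auto
          obtain K where K: "\<And>k. k \<ge> K \<Longrightarrow> dist (z (r k)) x < \<epsilon>/2"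
            using lim \<epsilon> unfolding lim_sequentially by (metis comp_apply half_gt_zero)
          define k where "k = max K M"
          have "M \<le> N + r k" using seq_suble[OF r, of k] by (simp add: k_def)
          have "\<exists>y\<in>\<sigma> n. dist x y < \<epsilon>" if "n \<ge> M" for n
          proof -
            obtain y where "y \<in> \<sigma> n" "dist (z (r k)) y < \<epsilon>/2"
              using hausdorff_dist_lessD[OF X S S M[OF \<open>M \<le> N + r k\<close> \<open>n \<ge> M\<close>] z(1)[of "r k"]] by auto
            moreover have "dist (z (r k)) x < \<epsilon>/2" using K by (simp add: k_def)
            ultimately show ?thesis
              using dist_triangle3[of x y "z (r k)"] by (intro bexI[of _ y]) auto
          qed
          then show "\<exists>N. \<forall>n\<ge>N. \<exists>y\<in>\<sigma> n. dist x y < \<epsilon>" by blast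
        qed (rule x)
        moreover have "dist y x \<le> e/2"
          using z(2) by (intro LIMSEQ_le_const2[OF tendsto_dist[OF tendsto_const lim]]) (auto intro: less_imp_le)
        then have "dist x y < e" using e by (simp add: dist_commute)
        ultimately show ?thesis by blast
      qed
      ultimately show ?thesis by blast
    qed
    have "closed L"
      unfolding closed_sequential_limits
    proof (intro allI impI, elim conjE)
      fix u l assume u: "\<forall>n. u n \<in> L" and lim: "u \<longlonglongrightarrow> l"
      have "l \<in> X" using u lim compact_imp_closed[OF X] unfolding L_def closed_sequential_limits by blast
      moreover have "\<exists>N. \<forall>n\<ge>N. \<exists>y\<in>\<sigma> n. dist l y < e" if e: "e > 0" for e
      proof -
        obtain k where k: "dist (u k) l < e/2" using lim e unfolding lim_sequentially by (metis half_gt_zero order_refl)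
        obtain N where "\<And>n. n \<ge> N \<Longrightarrow> \<exists>y\<in>\<sigma> n. dist (u k) y < e/2"
          using near[of "e/2"] u e by (metis half_gt_zero)
        then have "\<exists>y\<in>\<sigma> n. dist l y < e" if "n \<ge> N" for n
          using that k dist_triangle3[of l _ "u k"] by (smt (verit) field_sum_of_halves)
        then show ?thesis by blast
      qed
      ultimately show "l \<in> L" by (simp add: L_def)
    qed
    moreover have "L \<subseteq> X" by (auto simp: L_def)
    ultimately have "compact L" using X compact_Int_closed[of X L] by (simp add: Int_absorb1)
    moreover have "connected L"
    proof (rule connected_hausdorff_limit[OF \<open>compact L\<close>])
      fix e :: real assume "e > 0"
      then obtain N where "(\<forall>x\<in>L. \<exists>y\<in>\<sigma> N. dist x y < e) \<and> (\<forall>y\<in>\<sigma> N. \<exists>x\<in>L. dist x y < e)"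
        using near by blast
      then show "\<exists>C. connected C \<and> (\<forall>x\<in>L. \<exists>y\<in>C. dist x y < e) \<and> (\<forall>y\<in>C. \<exists>x\<in>L. dist x y < e)"
        using subcontinuaD(6)[OF X S] by blast
    qed
    moreover have "L \<noteq> {}"
    proof -
      obtain N where "\<forall>y\<in>\<sigma> N. \<exists>x\<in>L. dist x y < 1" using near[of 1] by auto
      then show ?thesis using subcontinuaD(1)[OF X S[of N]] by blast
    qed
    ultimately have L: "L \<in> subcontinua X"
      using \<open>L \<subseteq> X\<close> by (intro subcontinuaI) (auto intro: compact_imp_closed)
    have "\<exists>N. \<forall>n\<ge>N. hausdorff_dist (\<sigma> n) L < e" if e: "e > 0" for e
    proof -
      obtain N where N: "\<And>n. n \<ge> N \<Longrightarrow> (\<forall>x\<in>L. \<exists>y\<in>\<sigma> n. dist x y < e/2) \<and> (\<forall>y\<in>\<sigma> n. \<exists>x\<in>L. dist x y < e/2)"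
        using near[of "e/2"] e by auto
      have "hausdorff_dist (\<sigma> n) L \<le> e/2" if "n \<ge> N" for n
        using N[OF that] by (intro hausdorff_dist_le subcontinuaD[OF X S] subcontinuaD[OF X L])
          (metis dist_commute less_imp_le)+
      then show ?thesis using e by force
    qed
    then have "limitin mtopology \<sigma> L sequentially"
      using L S by (simp add: limit_metric_sequentially)
    then show "\<exists>x. limitin mtopology \<sigma> x sequentially" by blast
  qed
qed

text \<open>Record for every \<open>A\<close> which points of a finite \<open>1/(n+1)\<close>-net of \<open>X\<close> are close to \<open>A\<close>. There are finitely
many records for each \<open>n\<close>, and subcontinua with the same record are within \<open>2/(n+1)\<close> of each other; one
representative \<open>R n S\<close> for each occurring record \<open>S\<close> therefore gives a countable base of balls.\<close>

lemma second_countable_hyperspace: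
  assumes X: "compact X"
  shows "second_countable (hyperspace X)"
proof -
  interpret Metric_space "subcontinua X" hausdorff_dist
    by (rule Metric_space_hausdorff_dist[OF X])
  have "\<exists>F. finite F \<and> X \<subseteq> (\<Union>f\<in>F. ball f (1 / Suc n))" for n
    using compactE_image[OF X, of X "\<lambda>f. ball f (1 / Suc n)"] by (metis UN_I centre_in_ball of_nat_0_less_iff open_ball subsetI zero_less_Suc zero_less_divide_1_iff)
  then obtain F where F: "\<And>n. finite (F n)" "\<And>n. X \<subseteq> (\<Union>f\<in>F n. ball f (1 / Suc n))" by metis
  define tr where "tr n A = {f \<in> F n. \<exists>a\<in>A. dist f a < 1 / Suc n}" for n and A :: "'a set"
  define R where "R n S = (SOME A. A \<in> subcontinua X \<and> tr n A = S)" for n S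
  define \<B> where "\<B> = (\<Union>n. (\<lambda>S. mball (R n S) (3 / Suc n)) ` Pow (F n))"
  have R: "R n (tr n A) \<in> subcontinua X \<and> tr n (R n (tr n A)) = tr n A" if "A \<in> subcontinua X" for n A
    unfolding R_def by (rule someI[of _ A]) (use that in simp)
  have close: "\<exists>b\<in>B. dist a b < 2 / Suc n"
    if A: "a \<in> A" "A \<subseteq> X" "tr n A = tr n B" for a A B n
  proof -
    have "a \<in> (\<Union>f\<in>F n. ball f (1 / Suc n))" using F(2)[of n] A(1,2) by blast
    then obtain f where f: "f \<in> F n" "dist f a < 1 / Suc n" by auto
    then have "f \<in> tr n A" using A(1) unfolding tr_def by blast
    then have "f \<in> tr n B" using A(3) by simp
    then obtain b where "b \<in> B" "dist f b < 1 / Suc n" unfolding tr_def by blast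
    moreover have "dist a b < 1 / Suc n + 1 / Suc n"
      using f(2) \<open>dist f b < 1 / Suc n\<close> dist_triangle3[of a b f] by linarith
    then have "dist a b < 2 / Suc n" by simp
    ultimately show ?thesis by blast
  qed
  have dist_tr: "hausdorff_dist A B < 3 / Suc n"
    if A: "A \<in> subcontinua X" and B: "B \<in> subcontinua X" and "tr n A = tr n B" for A B n
  proof -
    have "hausdorff_dist A B \<le> 2 / Suc n"
    proof (rule hausdorff_dist_le)
      show "\<exists>b\<in>B. dist a b \<le> 2 / Suc n" if "a \<in> A" for a
        using close[OF that subcontinuaD(2)[OF X A] \<open>tr n A = tr n B\<close>] by force
      show "\<exists>a\<in>A. dist a b \<le> 2 / Suc n" if "b \<in> B" for b
        using close[OF that subcontinuaD(2)[OF X B] \<open>tr n A = tr n B\<close>[symmetric]]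
        by (metis dist_commute less_imp_le)
    qed (use subcontinuaD[OF X A] subcontinuaD[OF X B] in auto)
    then show ?thesis by (simp add: divide_simps)
  qed
  show ?thesis
    unfolding second_countable_def
  proof (intro exI[of _ \<B>] conjI ballI allI impI)
    have "countable (Pow (F n))" for n using F(1) by (simp add: countable_finite)
    then show "countable \<B>" unfolding \<B>_def by (intro countable_UN countable_image) simp_all
    show "openin (hyperspace X) V" if "V \<in> \<B>" for V
      using that unfolding \<B>_def hyperspace_def by auto
    fix U A assume "openin (hyperspace X) U \<and> A \<in> U"
    then obtain r where A: "A \<in> subcontinua X" and r: "r > 0" "mball A r \<subseteq> U"
      unfolding hyperspace_def openin_mtopology by blast
    obtain n where n: "1 / real (Suc n) < r / 6" using nat_approx_posE[of "r / 6"] r(1) by auto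
    let ?B = "R n (tr n A)"
    have B: "?B \<in> subcontinua X" and d: "hausdorff_dist A ?B < 3 / Suc n"
      using R[OF A, of n] dist_tr[OF A, of ?B n] by auto
    show "\<exists>V\<in>\<B>. A \<in> V \<and> V \<subseteq> U"
    proof (intro bexI[of _ "mball ?B (3 / Suc n)"] conjI)
      show "mball ?B (3 / Suc n) \<in> \<B>" unfolding \<B>_def tr_def by blast
      show "A \<in> mball ?B (3 / Suc n)" using A B d by (simp add: commute)
      have "mball ?B (3 / Suc n) \<subseteq> mball A r"
      proof
        fix C assume C: "C \<in> mball ?B (3 / Suc n)"
        then have "hausdorff_dist A C < 6 * (1 / Suc n)"
          using triangle[OF A B, of C] d by auto
        then show "C \<in> mball A r" using n A C by auto
      qed
      then show "mball ?B (3 / Suc n) \<subseteq> U" using r(2) by blast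
    qed
  qed
qed

section \<open>Connectedness and cut points in a dendrite\<close>

lemma dendriteD:
  assumes "dendrite X"
  shows "compact X" "connected X" "locally connected X"
proof -
  show "compact X" "connected X"
    using assms by (auto simp: dendrite_def dendroid_def continuum_def)
  have nb: "neighbourhood_base_of (connectedin (top_of_set X)) (top_of_set X)"
    using assms by (simp add: dendrite_def locally_connected_space_def)
  show "locally connected X"
    unfolding locally_def
  proof (intro allI impI, elim conjE)
    fix W x assume "openin (top_of_set X) W" "x \<in> W"
    then obtain U V where "openin (top_of_set X) U" "connectedin (top_of_set X) V" "x \<in> U" "U \<subseteq> V" "V \<subseteq> W"
      using nb unfolding neighbourhood_base_of by metis
    then show "\<exists>U V. openin (top_of_set X) U \<and> connected V \<and> x \<in> U \<and> U \<subseteq> V \<and> V \<subseteq> W"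
      by (auto simp: connectedin_subtopology)
  qed
qed

lemma dendrite_arc:
  assumes "dendrite X" "x \<in> X" "y \<in> X" "x \<noteq> y"
  obtains g where "arc g" "path_image g \<subseteq> X" "pathstart g = x" "pathfinish g = y"
proof -
  have "arcwise_connected X" using assms(1) by (simp add: dendrite_def dendroid_def)
  then show thesis using assms(2-4) that unfolding arcwise_connected_def by metis
qed

text \<open>If \<open>A\<close> and \<open>B\<close> meet, this is unicoherence of the subcontinuum \<open>A \<union> B\<close>.\<close>

lemma dendrite_connected_Int:
  assumes "dendrite X" "closed A" "connected A" "A \<subseteq> X" "closed B" "connected B" "B \<subseteq> X"
  shows "connected (A \<inter> B)"
proof (cases "A \<inter> B = {}")
  case False
  then have "A \<union> B \<in> subcontinua X"
    using assms by (intro subcontinuaI) (auto intro: connected_Un)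
  then have "unicoherent (A \<union> B)"
    using assms(1) by (simp add: dendrite_def dendroid_def hereditarily_unicoherent_def)
  then show ?thesis
    unfolding unicoherent_def using assms by (simp add: closed_subset)
qed simp

lemma small_connected_neighbourhood:
  fixes X :: "'a::metric_space set"
  assumes "compact X" "locally connected X" "openin (top_of_set X) W" "x \<in> W"
  obtains N where "openin (top_of_set X) N" "connected N" "x \<in> N" "closure N \<subseteq> W"
proof -
  obtain e where e: "e > 0" "ball x e \<inter> X \<subseteq> W"
    using assms(3,4) by (meson openin_contains_ball)
  have "x \<in> X" using assms(3,4) openin_imp_subset by blast
  then have "openin (top_of_set X) (X \<inter> ball x (e/2))" "x \<in> X \<inter> ball x (e/2)"
    using e(1) by (auto intro: openin_open_Int)
  then obtain N where N: "openin (top_of_set X) N" "connected N" "x \<in> N" "N \<subseteq> X \<inter> ball x (e/2)"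
    using assms(2) unfolding locally_connected by metis
  have "closure N \<subseteq> X \<inter> cball x (e/2)"
    using N(4) compact_imp_closed[OF assms(1)] by (intro closure_minimal) auto
  also have "\<dots> \<subseteq> W" using e by auto
  finally show thesis using that N(1-3) by blast
qed

text \<open>Call two points of \<open>W\<close> related if a connected open set with closure in \<open>W\<close> contains both. The classes
of this equivalence relation are open, so connectedness of \<open>W\<close> leaves only one class; finitely many
such sets through a common point cover \<open>K\<close>.\<close>

lemma connected_exhaustion:
  fixes X :: "'a::metric_space set"
  assumes X: "compact X" "locally connected X"
    and W: "openin (top_of_set X) W" "connected W" and K: "compact K" "K \<subseteq> W"
  obtains G where "openin (top_of_set X) G" "connected G" "K \<subseteq> G" "closure G \<subseteq> W"
proof (cases "K = {}")
  case True
  then show thesis using that[of "{}"] by simp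
next
  case False
  then obtain x where x: "x \<in> W" using K(2) by blast
  define R where "R y z \<longleftrightarrow> (\<exists>G. openin (top_of_set X) G \<and> connected G \<and> closure G \<subseteq> W \<and> y \<in> G \<and> z \<in> G)" for y z
  have R: "R x y" if "y \<in> W" for y
  proof (rule connected_equivalence_relation[OF W(2) x that])
    show "R b a" if "R a b" for a b using that unfolding R_def by blast
    show "R a c" if ac: "R a b" "R b c" for a b c
    proof -
      obtain G H where "openin (top_of_set X) G" "connected G" "closure G \<subseteq> W" "a \<in> G" "b \<in> G"
        "openin (top_of_set X) H" "connected H" "closure H \<subseteq> W" "b \<in> H" "c \<in> H"
        using ac unfolding R_def by metis
      then show ?thesis
        unfolding R_def by (intro exI[of _ "G \<union> H"]) (auto intro: connected_Un)
    qed
    show "\<exists>T. openin (top_of_set W) T \<and> a \<in> T \<and> (\<forall>x\<in>T. R a x)" if aW: "a \<in> W" for a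
    proof -
      obtain N where N: "openin (top_of_set X) N" "connected N" "a \<in> N" "closure N \<subseteq> W"
        using small_connected_neighbourhood[OF X W(1) aW] by blast
      then have "N \<subseteq> W" using closure_subset by blast
      then have "openin (top_of_set W) N"
        using N(1) openin_imp_subset[OF W(1)] by (meson openin_subset_trans)
      then show ?thesis using N unfolding R_def by blast
    qed
  qed
  then obtain G where G: "\<And>y. y \<in> W \<Longrightarrow> openin (top_of_set X) (G y) \<and> connected (G y) \<and> closure (G y) \<subseteq> W \<and> x \<in> G y \<and> y \<in> G y"
    unfolding R_def by metis
  then obtain Q where Q: "\<And>y. y \<in> W \<Longrightarrow> open (Q y) \<and> G y = X \<inter> Q y"
    unfolding openin_open by metis
  obtain D where D: "D \<subseteq> K" "finite D" "K \<subseteq> (\<Union>y\<in>D. Q y)"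
  proof (rule compactE_image[OF K(1), of K Q])
    show "open (Q y)" if "y \<in> K" for y using Q that K(2) by blast
    show "K \<subseteq> (\<Union>y\<in>K. Q y)" using G Q K(2) by blast
  qed
  have "D \<noteq> {}" using D(3) False by auto
  show thesis
  proof (rule that[of "\<Union>y\<in>D. G y"])
    show "openin (top_of_set X) (\<Union>y\<in>D. G y)" using G D(1) K(2) by blast
    show "connected (\<Union>y\<in>D. G y)"
    proof (rule connected_Union)
      show "\<Inter> (G ` D) \<noteq> {}" using G D(1) K(2) by blast
    qed (use G D(1) K(2) in blast)
    show "K \<subseteq> (\<Union>y\<in>D. G y)"
    proof
      fix k assume "k \<in> K"
      then obtain y where "y \<in> D" "k \<in> Q y" using D(3) by blast
      moreover have "k \<in> X" using \<open>k \<in> K\<close> K(2) openin_imp_subset[OF W(1)] by blast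
      moreover have "G y = X \<inter> Q y" using Q \<open>y \<in> D\<close> D(1) K(2) by blast
      ultimately show "k \<in> (\<Union>y\<in>D. G y)" by blast
    qed
    have "(\<Union>y\<in>D. G y) \<subseteq> (\<Union>y\<in>D. closure (G y))" using closure_subset by blast
    moreover have "closed (\<Union>y\<in>D. closure (G y))" using D(2) by (intro closed_UN) auto
    ultimately have "closure (\<Union>y\<in>D. G y) \<subseteq> (\<Union>y\<in>D. closure (G y))" by (rule closure_minimal)
    then show "closure (\<Union>y\<in>D. G y) \<subseteq> W" using G D(1) K(2) by blast
  qed
qed

lemma openin_Diff_singleton: "openin (top_of_set X) (X - {d::'a::metric_space})"
  by (rule openin_delete) simp

lemma component_openin:
  assumes "dendrite X" "C \<in> components (X - {d})"
  shows "openin (top_of_set X) C"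
  using locally_connected_open_component dendriteD(3)[OF assms(1)] assms(2) openin_Diff_singleton
  by blast

lemma closure_component:
  assumes "closed X" "C \<in> components (X - {d})"
  shows "closure C \<subseteq> insert d C"
proof -
  have "closedin (top_of_set (X - {d})) C" using assms(2) by (rule closedin_component)
  then obtain T where T: "closed T" "C = (X - {d}) \<inter> T" unfolding closedin_closed by blast
  then have "closure C \<subseteq> X \<inter> T" using assms(1) by (intro closure_minimal) auto
  then show ?thesis using T(2) by blast
qed

text \<open>If \<open>d\<close> were not in the closure, \<open>C\<close> would be a proper clopen subset of the connected space \<open>X\<close>.\<close>

lemma closure_cut_component:
  assumes X: "dendrite X" and d: "d \<in> X" and C: "C \<in> components (X - {d})"
  shows "closure C = insert d C"
proof -
  have cX: "closed X" using compact_imp_closed[OF dendriteD(1)[OF X]] .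
  have sub: "closure C \<subseteq> insert d C" using closure_component[OF cX C] .
  have "d \<in> closure C"
  proof (rule ccontr)
    assume "d \<notin> closure C"
    then have "closure C = C" using sub closure_subset[of C] by blast
    then have "closedin (top_of_set X) C"
      using in_components_subset[OF C] by (metis Diff_subset closed_closure closed_subset subset_trans)
    then have "C = {} \<or> C = X"
      using component_openin[OF X C] dendriteD(2)[OF X] unfolding connected_clopen by blast
    then show False using in_components_nonempty[OF C] in_components_subset[OF C] d by blast
  qed
  then show ?thesis using sub closure_subset[of C] by blast
qed

lemma component_subset_continuum:
  assumes "dendrite X" "C \<in> components (X - {d})" "a \<in> C" "b \<in> C"
  obtains L where "closed L" "connected L" "L \<subseteq> X - {d}" "a \<in> L" "b \<in> L"
proof -
  have "openin (top_of_set X) C" "connected C" "C \<subseteq> X - {d}"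
    using component_openin[OF assms(1,2)] in_components_connected[OF assms(2)] in_components_subset[OF assms(2)] by auto
  moreover have "compact {a, b}" "{a, b} \<subseteq> C" using assms(3,4) by auto
  ultimately obtain G where "connected G" "{a,b} \<subseteq> G" "closure G \<subseteq> C"
    using connected_exhaustion[OF dendriteD(1,3)[OF assms(1)]] by metis
  then show thesis
    using that[of "closure G"] \<open>C \<subseteq> X - {d}\<close> closure_subset[of G]
    by (auto intro: connected_imp_connected_closure)
qed

text \<open>A continuum \<open>L\<close> that avoids \<open>d\<close> and joins \<open>e\<close> to \<open>a\<close> would meet the continuum \<open>P \<union> Q\<close> in a
disconnected set, as its traces on \<open>P\<close> and on \<open>Q\<close> are closed, disjoint and nonempty. This is the only way
in which points are shown to be separated: it applies to the two halves of an arc and to the three legs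
of a triod.\<close>

lemma meeting_point_separates:
  assumes X: "dendrite X"
    and P: "closed P" "connected P" "P \<subseteq> X" and Q: "closed Q" "connected Q" "Q \<subseteq> X"
    and d: "P \<inter> Q = {d}" and e: "e \<in> P" "e \<noteq> d" and a: "a \<in> Q" "a \<noteq> d"
    and C: "C \<in> components (X - {d})" "e \<in> C"
  shows "a \<notin> C"
proof
  assume "a \<in> C"
  then obtain L where L: "closed L" "connected L" "L \<subseteq> X - {d}" "e \<in> L" "a \<in> L"
    using component_subset_continuum[OF X C(1) C(2) \<open>a \<in> C\<close>] by metis
  have "connected (P \<union> Q)" using connected_Un[OF P(2) Q(2)] d by simp
  moreover have "L \<subseteq> X" "P \<union> Q \<subseteq> X" using L(3) P(3) Q(3) by auto
  ultimately have "connected (L \<inter> (P \<union> Q))"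
    using dendrite_connected_Int[OF X L(1,2) _ closed_Un[OF P(1) Q(1)]] by metis
  moreover have "P \<inter> Q \<inter> (L \<inter> (P \<union> Q)) = {}" using d L(3) by blast
  moreover have "P \<inter> (L \<inter> (P \<union> Q)) \<noteq> {}" "Q \<inter> (L \<inter> (P \<union> Q)) \<noteq> {}" using L e a by blast+
  moreover have "L \<inter> (P \<union> Q) \<subseteq> P \<union> Q" by blast
  ultimately show False using connected_closedD[of "L \<inter> (P \<union> Q)" P Q] P(1) Q(1) by metis
qed

lemma connected_crosses:
  assumes "connected S" "S \<subseteq> X" "U \<in> components (X - {d})" "V \<in> components (X - {d})" "U \<noteq> V"
    and "S \<inter> U \<noteq> {}" "S \<inter> V \<noteq> {}"
  shows "d \<in> S"
proof (rule ccontr)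
  assume "d \<notin> S"
  then have "S \<subseteq> X - {d}" using assms(2) by blast
  then have "S \<subseteq> U" "S \<subseteq> V"
    using components_maximal[OF assms(3,1)] components_maximal[OF assms(4,1)] assms(6,7) by blast+
  then show False using assms(3-6) components_nonoverlap by blast
qed

lemma component_containing:
  assumes "S \<subseteq> X - {d}" "connected S" "S \<noteq> {}"
  obtains C where "C \<in> components (X - {d})" "S \<subseteq> C"
  using assms exists_component_superset[of S "X - {d}"] by auto

text \<open>If removing \<open>e\<close> disconnected \<open>X\<close>, every small neighbourhood of \<open>e\<close> would have a boundary point in
each of two components, hence two boundary points.\<close>

lemma endpoint_connected_Diff:
  assumes X: "dendrite X" and e: "e \<in> endpoints X"
  shows "connected (X - {e})"
proof (rule ccontr)
  assume "\<not> connected (X - {e})"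
  then obtain U V where UV: "U \<in> components (X - {e})" "V \<in> components (X - {e})" "U \<noteq> V"
    by (metis connected_eq_connected_components_eq connected_iff_eq_connected_component_set components_iff)
  obtain u v where u: "u \<in> U" "v \<in> V" using UV in_components_nonempty by blast
  have sub: "U \<subseteq> X - {e}" "V \<subseteq> X - {e}" using UV in_components_subset by blast+
  have "e \<in> X" "order_at_most X e {e}" using e by (auto simp: endpoints_def has_order_def)
  have "X - {u,v} = X - {u} - {v}" by blast
  then have "openin (top_of_set X) (X - {u,v})"
    using openin_delete[OF openin_Diff_singleton, of X u v] by simp
  then obtain N where N: "openin (top_of_set X) N" "e \<in> N" "N \<subseteq> X - {u,v}"
      "(top_of_set X) frontier_of N \<lesssim> {e}"
    using \<open>order_at_most X e {e}\<close> \<open>e \<in> X\<close> u sub unfolding order_at_most_def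
    by (metis Diff_iff insertE singletonI subsetD singletonD)
  have front: "(top_of_set X) frontier_of N \<inter> C \<noteq> {}"
    if C: "C \<in> components (X - {e})" and c: "c \<in> C" "c \<notin> N" for C c
  proof -
    have "C \<subseteq> X - {e}" using C in_components_subset by blast
    have "connected (insert e C)"
      using in_components_connected[OF C] closure_cut_component[OF X \<open>e \<in> X\<close> C]
      by (metis closure_subset connected_intermediate_closure order_refl)
    then have "connectedin (top_of_set X) (insert e C)"
      using \<open>C \<subseteq> X - {e}\<close> \<open>e \<in> X\<close> by (auto simp: connectedin_subtopology)
    then have "insert e C \<inter> (top_of_set X) frontier_of N \<noteq> {}"
      using connectedin_Int_frontier_of[of "top_of_set X" "insert e C" N] N(2) c by blast
    moreover have "e \<notin> (top_of_set X) frontier_of N"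
      using N(1,2) by (simp add: frontier_of_def interior_of_openin)
    ultimately show ?thesis by blast
  qed
  obtain p q where "p \<in> (top_of_set X) frontier_of N \<inter> U" "q \<in> (top_of_set X) frontier_of N \<inter> V"
    using front[OF UV(1) u(1)] front[OF UV(2) u(2)] N(3) by blast
  moreover from this have "p = q"
    using N(4) unfolding lepoll_def inj_on_def by blast
  ultimately show False using UV components_nonoverlap by blast
qed

section \<open>Branch points\<close>

definition branch_point :: "'a::metric_space set \<Rightarrow> 'a \<Rightarrow> bool" where
  "branch_point X d \<longleftrightarrow> d \<in> X \<and>
    (\<exists>U V W. {U, V, W} \<subseteq> components (X - {d}) \<and> U \<noteq> V \<and> V \<noteq> W \<and> U \<noteq> W)"

lemma arc_split:
  fixes g :: "real \<Rightarrow> 'a::metric_space"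
  assumes "arc g" "0 \<le> s" "s \<le> 1"
  shows "closed (g ` {0..s})" "connected (g ` {0..s})" "closed (g ` {s..1})" "connected (g ` {s..1})"
    "g ` {0..s} \<inter> g ` {s..1} = {g s}"
proof -
  have c: "continuous_on {0..1} g" and i: "inj_on g {0..1}"
    using assms(1) by (auto simp: arc_def path_def)
  have "compact (g ` {0..s})" "compact (g ` {s..1})"
    using assms by (auto intro!: compact_continuous_image continuous_on_subset[OF c])
  then show "closed (g ` {0..s})" "closed (g ` {s..1})" by (auto intro: compact_imp_closed)
  show "connected (g ` {0..s})" "connected (g ` {s..1})"
    using assms by (auto intro!: connected_continuous_image continuous_on_subset[OF c])
  have "g ` {0..s} \<inter> g ` {s..1} = g ` ({0..s} \<inter> {s..1})"
    using assms by (intro inj_on_image_Int[OF i, symmetric]) auto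
  also have "{0..s} \<inter> {s..1} = {s}" using assms by auto
  finally show "g ` {0..s} \<inter> g ` {s..1} = {g s}" by simp
qed

lemma arc_inner_point_separates:
  assumes "dendrite X" "arc g" "path_image g \<subseteq> X" "0 < s" "s < 1"
    and "C \<in> components (X - {g s})" "pathstart g \<in> C"
  shows "pathfinish g \<notin> C"
proof (rule meeting_point_separates[OF assms(1), where P = "g ` {0..s}" and Q = "g ` {s..1}"])
  have i: "inj_on g {0..1}" using assms(2) by (simp add: arc_def)
  show "g ` {0..s} \<subseteq> X" "g ` {s..1} \<subseteq> X" using assms(3-5) by (auto simp: path_image_def)
  show "pathstart g \<noteq> g s" "pathfinish g \<noteq> g s"
    using inj_onD[OF i, of 0 s] inj_onD[OF i, of 1 s] assms(4,5) by (auto simp: pathstart_def pathfinish_def)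
  show "pathstart g \<in> g ` {0..s}" "pathfinish g \<in> g ` {s..1}"
    using assms(4,5) by (auto simp: pathstart_def pathfinish_def)
qed (use assms arc_split[OF assms(2), of s] in auto)

text \<open>Each inner point of the arc separates its ends, so no connected set containing both ends can miss it.\<close>

lemma arc_subset_connected:
  assumes X: "dendrite X" and h: "arc h" "path_image h \<subseteq> X" and L: "connected L" "L \<subseteq> X"
    "pathstart h \<in> L" "pathfinish h \<in> L"
  shows "path_image h \<subseteq> L"
proof
  fix d assume "d \<in> path_image h"
  then obtain t where t: "0 \<le> t" "t \<le> 1" "d = h t" by (auto simp: path_image_def)
  show "d \<in> L"
  proof (rule ccontr)
    assume d: "d \<notin> L"
    then have "t \<noteq> 0" "t \<noteq> 1" using L t by (auto simp: pathstart_def pathfinish_def)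
    obtain C where C: "C \<in> components (X - {d})" "L \<subseteq> C"
      using component_containing[of L X d] L d by blast
    then show False
      using arc_inner_point_separates[OF X h, of t C] t \<open>t \<noteq> 0\<close> \<open>t \<noteq> 1\<close> L(3,4) by auto
  qed
qed

text \<open>An arc from \<open>A\<close> to \<open>B\<close> has a parameter interval \<open>{0..1} - J\<close> mapped outside \<open>A \<union> B\<close>. Near an inner point
of that part there is an endpoint of \<open>X\<close>; it is off the arc, because inner points of arcs are
cut points and endpoints are not. The arc \<open>h\<close> from this endpoint to the given arc arrives at a point \<open>d\<close>, and
\<open>d\<close> is the centre of a triod whose legs lie in distinct components of \<open>X - {d}\<close>.\<close>

lemma branch_point_between:
  assumes X: "dendrite X" and dense: "X \<subseteq> closure (endpoints X)"
    and A: "closed A" "connected A" "A \<subseteq> X" "A \<noteq> {}" and B: "closed B" "connected B" "B \<subseteq> X" "B \<noteq> {}"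
    and AB: "A \<inter> B = {}"
  obtains d U V where "branch_point X d" "U \<in> components (X - {d})" "V \<in> components (X - {d})"
    "U \<noteq> V" "A \<subseteq> U" "B \<subseteq> V"
proof -
  obtain a b where ab: "a \<in> A" "b \<in> B" using A B by blast
  then have "a \<in> X" "b \<in> X" "a \<noteq> b" using A(3) B(3) AB by auto
  then obtain g where g: "arc g" "path_image g \<subseteq> X" "pathstart g = a" "pathfinish g = b"
    using dendrite_arc[OF X] by metis
  have cg: "continuous_on {0..1} g" and ig: "inj_on g {0..1}"
    using g(1) by (auto simp: arc_def path_def)
  have g01: "g 0 = a" "g 1 = b" using g(3,4) by (auto simp: pathstart_def pathfinish_def)
  define TA where "TA = {0..1} \<inter> g -` A"
  define TB where "TB = {0..1} \<inter> g -` B"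
  have cl: "closed TA" "closed TB"
    unfolding TA_def TB_def using cg A(1) B(1) by (auto intro: continuous_closed_preimage)
  have "\<not> {0..1} \<subseteq> TA \<union> TB"
  proof
    assume "{0..1} \<subseteq> TA \<union> TB"
    moreover have "TA \<inter> TB \<inter> {0..1} = {}" using AB by (auto simp: TA_def TB_def)
    ultimately have "TA \<inter> {0..1} = {} \<or> TB \<inter> {0..1} = {}"
      using connected_closedD[OF connected_Icc _ _ cl] by blast
    moreover have "0 \<in> TA \<inter> {0..1}" "1 \<in> TB \<inter> {0..1}" using ab g01 by (auto simp: TA_def TB_def)
    ultimately show False by blast
  qed
  then obtain t where t: "t \<in> {0..1}" "t \<notin> TA \<union> TB" by blast
  obtain r where r: "r > 0" "ball t r \<inter> (TA \<union> TB) = {}"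
  proof -
    have "open (- (TA \<union> TB))" using cl by (intro open_Compl closed_Un)
    then obtain r where "r > 0" "ball t r \<subseteq> - (TA \<union> TB)" using t(2) by (meson ComplI openE)
    then show thesis using that by blast
  qed
  define J where "J = {0..1} - ball t r"
  have inner: "g s \<notin> A \<union> B \<and> 0 < s \<and> s < 1" if "s \<in> {0..1} - J" for s
  proof -
    have "s \<notin> TA" "s \<notin> TB" "s \<in> {0..1}" using that r(2) by (auto simp: J_def)
    then show ?thesis using ab g01 unfolding TA_def TB_def
      by (cases "s = 0"; cases "s = 1") auto
  qed
  have "compact (g ` J)"
    unfolding J_def by (intro compact_continuous_image continuous_on_subset[OF cg] compact_diff) auto
  then have "open (- (g ` J))" using compact_imp_closed by blast
  then have "openin (top_of_set X) (X - g ` J)"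
    using openin_open_Int[of "- (g ` J)" X] by (simp add: Diff_eq)
  moreover have "g t \<in> X - g ` J"
  proof -
    have "t \<notin> J" using r(1) by (simp add: J_def)
    then have "g t \<notin> g ` J" using inj_on_image_mem_iff[OF ig t(1), of J] by (auto simp: J_def)
    then show ?thesis using g(2) t(1) by (auto simp: path_image_def)
  qed
  \<comment> \<open>The connected neighbourhood \<open>N\<close> of \<open>g t\<close> confines \<open>h\<close>, which ensures that \<open>h\<close> meets the arc \<open>g\<close>
    strictly between \<open>A\<close> and \<open>B\<close>.\<close>
  ultimately obtain N where N: "openin (top_of_set X) N" "connected N" "g t \<in> N" "closure N \<subseteq> X - g ` J"
    using small_connected_neighbourhood[OF dendriteD(1,3)[OF X]] by metis
  have NX: "N \<subseteq> X - g ` J" using N(4) closure_subset by blast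
  obtain e where e: "e \<in> endpoints X" "e \<in> N"
  proof -
    obtain M where M: "open M" "N = X \<inter> M" using N(1) unfolding openin_open by blast
    then have "M \<inter> closure (endpoints X) \<noteq> {}" using N(3) dense by blast
    then have "M \<inter> endpoints X \<noteq> {}" using M(1) by (simp add: open_Int_closure_eq_empty)
    then show thesis using M(2) that by (auto simp: endpoints_def)
  qed
  have eX: "e \<in> X" using e(1) by (simp add: endpoints_def)
  have param: "\<exists>s. 0 < s \<and> s < 1 \<and> g s = x \<and> x \<notin> A \<union> B" if "x \<in> N" "x \<in> path_image g" for x
  proof -
    obtain s where s: "s \<in> {0..1}" "x = g s" using \<open>x \<in> path_image g\<close> by (auto simp: path_image_def)
    then have "s \<notin> J" using that NX by blast
    then show ?thesis using inner[of s] s by blast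
  qed
  have "e \<notin> path_image g"
  proof
    assume "e \<in> path_image g"
    then obtain s where s: "0 < s" "s < 1" "g s = e" "e \<notin> A \<union> B" using param e(2) by blast
    have "{a, b} \<subseteq> X - {e}" using ab A(3) B(3) s(4) by blast
    then have "X - {e} \<in> components (X - {e})"
      using endpoint_connected_Diff[OF X e(1)] by (auto simp: in_components_self)
    then show False
      using arc_inner_point_separates[OF X g(1,2) s(1,2), of "X - {e}"] s(3) g(3,4) \<open>{a, b} \<subseteq> X - {e}\<close> by auto
  qed
  then have "e \<noteq> g t" using t(1) by (auto simp: path_image_def)
  moreover have "g t \<in> X" using N(3) NX by blast
  ultimately obtain h where h: "arc h" "path_image h \<subseteq> X" "pathstart h = e" "pathfinish h = g t"
    using dendrite_arc[OF X eX] by metis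
  have hN: "path_image h \<subseteq> N"
    by (rule arc_subset_connected[OF X h(1,2) N(2)]) (use h(3,4) e(2) N(3) NX in auto)
  have ch: "continuous_on {0..1} h" using h(1) by (auto simp: arc_def path_def)
  have cpg: "closed (path_image g)" using g(1) by (simp add: closed_arc_image)
  let ?T = "{0..1} \<inter> h -` path_image g"
  have "closed ?T" using ch cpg by (intro continuous_closed_preimage) auto
  then have "compact ?T" by (metis compact_Icc compact_Int_closed inf.left_idem)
  moreover have "1 \<in> ?T" using h(4) t(1) by (auto simp: pathfinish_def path_image_def)
  \<comment> \<open>The first parameter at which \<open>h\<close> reaches \<open>g\<close>; up to then the two arcs share only the point \<open>d\<close>.\<close>
  ultimately obtain u where u: "u \<in> ?T" "\<And>v. v \<in> ?T \<Longrightarrow> u \<le> v"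
    using compact_attains_inf[of ?T] by blast
  define d where "d = h u"
  define H where "H = h ` {0..u}"
  have H: "closed H" "connected H" "H \<subseteq> X" "e \<in> H"
    using arc_split[OF h(1), of u] u(1) h(2,3) by (auto simp: H_def path_image_def pathstart_def)
  have "d \<in> path_image h" using u(1) by (auto simp: d_def path_image_def)
  then have d: "d \<in> path_image g" "d \<in> N" using u(1) hN by (auto simp: d_def)
  have Hg: "H \<inter> path_image g = {d}"
  proof -
    have "x = d" if "x \<in> H" "x \<in> path_image g" for x
    proof -
      obtain v where v: "0 \<le> v" "v \<le> u" "x = h v" using \<open>x \<in> H\<close> by (auto simp: H_def)
      then have "v \<in> ?T" using that u(1) by auto
      then show ?thesis using u(2) v by (force simp: d_def)
    qed
    moreover have "d \<in> H" using u(1) by (auto simp: d_def H_def)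
    ultimately show ?thesis using d(1) by blast
  qed
  obtain s where s: "0 < s" "s < 1" "g s = d" "d \<notin> A \<union> B" using param d by blast
  have ed: "e \<noteq> d" using d(1) \<open>e \<notin> path_image g\<close> by blast
  have dX: "d \<in> X" using d(2) NX by blast
  obtain U where U: "U \<in> components (X - {d})" "A \<subseteq> U"
    using component_containing[of A X d] A s(4) by blast
  obtain V where V: "V \<in> components (X - {d})" "B \<subseteq> V"
    using component_containing[of B X d] B s(4) by blast
  obtain W where W: "W \<in> components (X - {d})" "e \<in> W"
    using component_containing[of "{e}" X d] eX ed by auto
  have "b \<notin> U"
    using arc_inner_point_separates[OF X g(1,2) s(1,2), of U] U ab s(3) g(3,4) by auto
  then have "U \<noteq> V" using V ab by blast
  have part: "c \<notin> W" if R: "R = g ` {0..s} \<or> R = g ` {s..1}" and c: "c \<in> R" "c \<noteq> d" for R c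
  proof (rule meeting_point_separates[OF X H(1-3), where Q = R and e = e and d = d])
    have "R \<subseteq> path_image g" using R s by (auto simp: path_image_def)
    moreover have "d \<in> R" using R s by auto
    ultimately show "H \<inter> R = {d}" "R \<subseteq> X" using Hg g(2) by blast+
  qed (use R c H(4) ed W arc_split[OF g(1), of s] s in auto)
  have "a \<notin> W" "b \<notin> W"
    using part[of "g ` {0..s}" a] part[of "g ` {s..1}" b] s ab g01 by force+
  then have "U \<noteq> W" "V \<noteq> W" using U V ab by blast+
  then have "branch_point X d"
    unfolding branch_point_def using dX U V W \<open>U \<noteq> V\<close> by blast
  then show thesis using that U V \<open>U \<noteq> V\<close> by blast
qed

text \<open>A branch point separating \<open>x\<close> from a second point of \<open>A\<close> belongs to \<open>A\<close>. If the second point is taken in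
a small connected neighbourhood of \<open>x\<close>, the branch point belongs to that neighbourhood as well.\<close>

lemma branch_point_near:
  assumes X: "dendrite X" and dense: "X \<subseteq> closure (endpoints X)"
    and A: "connected A" "A \<subseteq> X" "x \<in> A" "A \<noteq> {x}" and "e > 0"
  obtains d where "branch_point X d" "d \<in> A" "dist x d < e"
proof -
  have "openin (top_of_set X) (X \<inter> ball x e)" "x \<in> X \<inter> ball x e"
    using A \<open>e > 0\<close> by (auto intro: openin_open_Int)
  then obtain N where N: "openin (top_of_set X) N" "connected N" "x \<in> N" "N \<subseteq> X \<inter> ball x e"
    using dendriteD(3)[OF X] unfolding locally_connected by metis
  obtain M where M: "open M" "N = X \<inter> M" using N(1) unfolding openin_open by blast
  have "x islimpt A" using connected_imp_perfect[OF A(1) A(3)] A(3,4) by blast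
  then obtain z where z: "z \<in> A" "z \<in> M" "z \<noteq> x"
    using M N(3) unfolding islimpt_def by blast
  then have "z \<in> N" using A(2) M(2) by blast
  have "{x} \<inter> {z} = {}" using z(3) by auto
  moreover have "{x} \<subseteq> X" "{z} \<subseteq> X" using A z(1) by auto
  ultimately obtain d U V where d: "branch_point X d" "U \<in> components (X - {d})"
    "V \<in> components (X - {d})" "U \<noteq> V" "{x} \<subseteq> U" "{z} \<subseteq> V"
    using branch_point_between[OF X dense closed_singleton connected_sing _ _ closed_singleton connected_sing]
    by (metis insert_not_empty)
  have "d \<in> A" using connected_crosses[OF A(1,2) d(2-4)] d A(3) z(1) by blast
  moreover have "d \<in> N" using connected_crosses[OF N(2) _ d(2-4)] d N(3,4) \<open>z \<in> N\<close> by blast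
  ultimately show thesis using that d(1) N(4) by auto
qed

text \<open>The complement of \<open>U\<close> is a compact subset of the connected open set \<open>X - A\<close>, so it lies in a
continuum disjoint from \<open>A\<close>. A branch point separating \<open>A\<close> from that continuum cuts off the required \<open>V\<close>.\<close>

lemma branch_cut_near:
  assumes X: "dendrite X" and dense: "X \<subseteq> closure (endpoints X)"
    and A: "A \<in> subcontinua X" "connected (X - A)" "A \<noteq> X"
    and U: "openin (top_of_set X) U" "A \<subseteq> U"
  obtains d V where "branch_point X d" "V \<in> components (X - {d})" "A \<subseteq> V" "closure V \<subseteq> U"
proof -
  note a = subcontinuaD[OF dendriteD(1)[OF X] A(1)]
  obtain z where z: "z \<in> X - A" using A(3) a(2) by blast
  have "compact (X - U)"
    using U(1) dendriteD(1)[OF X] closedin_compact[of X "X - U"] by (simp add: openin_closedin_eq)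
  \<comment> \<open>The extra point \<open>z\<close> keeps the continuum nonempty when \<open>U = X\<close>.\<close>
  then have "compact (insert z (X - U))" by simp
  moreover have "insert z (X - U) \<subseteq> X - A" using z U(2) by blast
  moreover have "openin (top_of_set X) (X - A)" using A(1) by (simp add: subcontinua_def openin_diff)
  ultimately obtain G where G: "connected G" "insert z (X - U) \<subseteq> G" "closure G \<subseteq> X - A"
    using connected_exhaustion[OF dendriteD(1,3)[OF X] _ A(2)] by metis
  have G': "connected (closure G)" "insert z (X - U) \<subseteq> closure G"
    using connected_imp_connected_closure[OF G(1)] G(2) closure_subset[of G] by blast+
  moreover have "closure G \<subseteq> X" "closure G \<noteq> {}" "A \<inter> closure G = {}" using G(3) G'(2) by auto
  ultimately obtain d V V' where d: "branch_point X d" "V \<in> components (X - {d})"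
    "V' \<in> components (X - {d})" "V \<noteq> V'" "A \<subseteq> V" "closure G \<subseteq> V'"
    using branch_point_between[OF X dense a(4,6,2,1) closed_closure] by metis
  have dis: "V \<inter> V' = {}" "d \<notin> V'"
    using d(4) components_nonoverlap[OF d(2,3)] in_components_subset[OF d(3)] by auto
  have clX: "closed X" using compact_imp_closed[OF dendriteD(1)[OF X]] .
  have "closure V \<subseteq> X" using in_components_subset[OF d(2)] clX by (intro closure_minimal) auto
  moreover have "closure V \<subseteq> insert d V" using closure_component[OF clX d(2)] .
  ultimately have "closure V \<subseteq> U" using G'(2) d(6) dis by blast
  then show thesis using that d by blast
qed

section \<open>Complete metrizability of the space of nonseparating subcontinua\<close>

definition nonseparating :: "'a::metric_space set \<Rightarrow> 'a set set" where
  "nonseparating X = {A \<in> subcontinua X. connected (X - A)}"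

lemma nonseparatingD:
  assumes "A \<in> nonseparating X"
  shows "A \<in> subcontinua X" "connected (X - A)"
  using assms by (auto simp: nonseparating_def)

lemma NC_star_eq: "NC_star X = subtopology (hyperspace X) (nonseparating X)"
  by (simp add: NC_star_def nonseparating_def)

lemma topspace_NC_star:
  assumes "compact X"
  shows "topspace (NC_star X) = nonseparating X"
  using topspace_hyperspace[OF assms] by (auto simp: NC_star_eq nonseparating_def)

text \<open>The set \<open>\<U> n\<close> collects those \<open>A\<close> for which the points at distance at least \<open>1/(n+1)\<close> from \<open>A\<close> lie in a
connected open set with closure missing \<open>A\<close>. It is open since the same \<open>G\<close> works for all
sufficiently near \<open>B\<close>. If \<open>A\<close> belongs to every \<open>\<U> n\<close>, any two points of \<open>X - A\<close> lie in one of the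
sets \<open>G\<close>; the converse inclusion is \<open>connected_exhaustion\<close>.\<close>

lemma gdelta_nonseparating:
  fixes X :: "'a::metric_space set"
  assumes X: "compact X" "locally connected X"
  shows "gdelta_in (hyperspace X) (nonseparating X)"
proof -
  define far where "far n A = {x \<in> X. \<forall>a\<in>A. 1 / Suc n \<le> dist x a}" for n and A :: "'a set"
  define \<U> where "\<U> n = {A \<in> subcontinua X. \<exists>G. openin (top_of_set X) G \<and> connected G \<and>
      A \<subseteq> X - closure G \<and> far n A \<subseteq> G}" for n
  have op: "openin (hyperspace X) (\<U> n)" for n
  proof (subst openin_subopen, intro ballI)
    fix A assume "A \<in> \<U> n"
    then obtain G where A: "A \<in> subcontinua X" and G: "openin (top_of_set X) G" "connected G"
      "A \<subseteq> X - closure G" "far n A \<subseteq> G" unfolding \<U>_def by blast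
    let ?S = "{B \<in> subcontinua X. B \<subseteq> X - closure G}"
    have "open (- closure G)" by auto
    then have "openin (top_of_set X) (X - closure G)"
      using openin_open_Int[of "- closure G" X] by (simp add: Diff_eq)
    then have S: "openin (hyperspace X) ?S" by (rule openin_hyperspace_subset[OF X(1)])
    have K: "compact (X - G)"
      using G(1) X(1) closedin_compact[of X "X - G"] by (simp add: openin_closedin_eq)
    \<comment> \<open>Outside \<open>G\<close> the distance to \<open>A\<close> is less than \<open>1/(n+1)\<close>; by compactness it stays below this bound by a
      fixed margin, which absorbs the passage from \<open>A\<close> to \<open>B\<close>.\<close>
    have "\<exists>\<delta>>0. \<forall>x\<in>X - G. \<exists>a\<in>A. dist x a < 1 / Suc n - \<delta>"
    proof (cases "X - G = {}")
      case False
      obtain z where z: "z \<in> X - G" "\<And>x. x \<in> X - G \<Longrightarrow> infdist x A \<le> infdist z A"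
        using continuous_attains_sup[OF K False continuous_on_infdist[OF continuous_on_id], of A] by blast
      then have "z \<notin> far n A" using G(4) by blast
      then obtain a where "a \<in> A" "dist z a < 1 / Suc n" using z(1) by (auto simp: far_def)
      then have lt: "infdist z A < 1 / Suc n" using infdist_le[of a A z] by simp
      define \<delta> where "\<delta> = (1 / Suc n - infdist z A) / 2"
      have "\<delta> > 0" using lt by (simp add: \<delta>_def)
      have half: "y = w - 2 * ((w - y) / 2)" for w y :: real by (simp add: field_simps)
      have "infdist z A = 1 / Suc n - 2 * \<delta>"
        using half[of "infdist z A" "1 / Suc n"] by (simp only: \<delta>_def)
      then have "infdist z A < 1 / Suc n - \<delta>" using \<open>\<delta> > 0\<close> by linarith
      have "\<exists>a\<in>A. dist x a < 1 / Suc n - \<delta>" if "x \<in> X - G" for x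
      proof -
        have "infdist x A < 1 / Suc n - \<delta>"
          using z(2)[OF that] \<open>infdist z A < 1 / Suc n - \<delta>\<close> by linarith
        then show ?thesis using infdist_less_obtain[OF _ subcontinuaD(1)[OF X(1) A]] by metis
      qed
      then show ?thesis using \<open>\<delta> > 0\<close> by blast
    qed (auto intro: exI[of _ 1])
    then obtain \<delta> where \<delta>: "\<delta> > 0" "\<And>x. x \<in> X - G \<Longrightarrow> \<exists>a\<in>A. dist x a < 1 / Suc n - \<delta>" by blast
    have near: "far n B \<subseteq> G" if B: "B \<in> subcontinua X" "hausdorff_dist A B < \<delta>" for B
    proof
      fix x assume x: "x \<in> far n B"
      show "x \<in> G"
      proof (rule ccontr)
        assume "x \<notin> G"
        then have "x \<in> X - G" using x by (simp add: far_def)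
        then obtain a where a: "a \<in> A" "dist x a < 1 / Suc n - \<delta>" using \<delta>(2) by blast
        then obtain b where "b \<in> B" "dist a b < \<delta>"
          using hausdorff_dist_lessD[OF X(1) A B] by blast
        then have "1 / Suc n \<le> dist x b" using x \<open>b \<in> B\<close> by (simp add: far_def)
        then show False using \<open>dist a b < \<delta>\<close> a(2) dist_triangle[of x b a] by linarith
      qed
    qed
    obtain \<epsilon> where \<epsilon>: "\<epsilon> > 0" "\<And>B. B \<in> subcontinua X \<Longrightarrow> hausdorff_dist A B < \<epsilon> \<Longrightarrow> B \<in> ?S"
      using openin_hyperspaceD[OF X(1) S, of A] A G(3) by blast
    interpret Metric_space "subcontinua X" hausdorff_dist
      by (rule Metric_space_hausdorff_dist[OF X(1)])
    show "\<exists>T. openin (hyperspace X) T \<and> A \<in> T \<and> T \<subseteq> \<U> n"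
    proof (intro exI[of _ "mball A (min \<delta> \<epsilon>)"] conjI)
      show "openin (hyperspace X) (mball A (min \<delta> \<epsilon>))" unfolding hyperspace_def by (rule openin_mball)
      show "A \<in> mball A (min \<delta> \<epsilon>)" using A \<delta>(1) \<epsilon>(1) by simp
      show "mball A (min \<delta> \<epsilon>) \<subseteq> \<U> n"
      proof
        fix B assume "B \<in> mball A (min \<delta> \<epsilon>)"
        then have "B \<in> subcontinua X" "hausdorff_dist A B < \<delta>" "hausdorff_dist A B < \<epsilon>" by auto
        then show "B \<in> \<U> n" using near \<epsilon>(2) G(1,2) unfolding \<U>_def by blast
      qed
    qed
  qed
  have "nonseparating X = (\<Inter>n. \<U> n)"
  proof (intro equalityI subsetI)
    fix A assume "A \<in> nonseparating X"
    then have A: "A \<in> subcontinua X" "connected (X - A)" by (rule nonseparatingD)+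
    have W: "openin (top_of_set X) (X - A)" using A(1) by (simp add: subcontinua_def openin_diff)
    have "A \<in> \<U> n" for n
    proof -
      have "far n A = X \<inter> (\<Inter>a\<in>A. {x. 1 / Suc n \<le> dist x a})" by (auto simp: far_def)
      moreover have "closed (\<Inter>a\<in>A. {x. 1 / Suc n \<le> dist x a})"
        by (intro closed_INT ballI closed_Collect_le continuous_intros)
      ultimately have "compact (far n A)" using X(1) by (simp add: compact_Int_closed)
      moreover have "far n A \<subseteq> X - A" by (force simp: far_def)
      ultimately obtain G where "openin (top_of_set X) G" "connected G" "far n A \<subseteq> G" "closure G \<subseteq> X - A"
        using connected_exhaustion[OF X W A(2)] by metis
      moreover from this have "A \<subseteq> X - closure G" using subcontinuaD(2)[OF X(1) A(1)] by blast
      ultimately show ?thesis using A(1) unfolding \<U>_def by blast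
    qed
    then show "A \<in> (\<Inter>n. \<U> n)" by blast
  next
    fix A assume "A \<in> (\<Inter>n. \<U> n)"
    then have U: "A \<in> \<U> n" for n by blast
    then have A: "A \<in> subcontinua X" by (auto simp: \<U>_def)
    have gap: "\<exists>e>0. \<forall>a\<in>A. e \<le> dist x a" if "x \<in> X - A" for x
      using compact_closed_gap[of "{x}" A] subcontinuaD(4)[OF X(1) A] that
      by (metis DiffD2 Int_insert_left_if0 compact_sing inf_bot_left singletonI)
    have "connected_component (X - A) x y" if xy: "x \<in> X - A" "y \<in> X - A" for x y
    proof -
      obtain e e' where e: "e > 0" "\<forall>a\<in>A. e \<le> dist x a" "e' > 0" "\<forall>a\<in>A. e' \<le> dist y a"
        using gap xy by metis
      then obtain n where n: "1 / real (Suc n) < min e e'" using nat_approx_posE[of "min e e'"] by auto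
      then have "x \<in> far n A" "y \<in> far n A" using e xy by (force simp: far_def)+
      moreover obtain G where "openin (top_of_set X) G" "connected G" "A \<subseteq> X - closure G" "far n A \<subseteq> G"
        using U[of n] unfolding \<U>_def by blast
      moreover from this have "G \<subseteq> X - A" using closure_subset[of G] openin_imp_subset by blast
      ultimately show ?thesis unfolding connected_component_def by blast
    qed
    then have "connected (X - A)" by (simp add: connected_iff_connected_component)
    then show "A \<in> nonseparating X" using A by (simp add: nonseparating_def)
  qed
  moreover have "gdelta_in (hyperspace X) (\<Inter>n. \<U> n)"
    by (rule gdelta_in_Inter) (auto intro!: open_imp_gdelta_in op)
  ultimately show ?thesis by simp
qed

lemma completely_metrizable_NC_star:
  assumes "compact X" "locally connected X"
  shows "completely_metrizable_space (NC_star X)"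
proof -
  have "completely_metrizable_space (hyperspace X)"
    unfolding completely_metrizable_space_def hyperspace_def
    using Metric_space_hausdorff_dist[OF assms(1)] mcomplete_hausdorff_dist[OF assms(1)] by blast
  then show ?thesis
    unfolding NC_star_eq by (rule completely_metrizable_space_gdelta_in) (rule gdelta_nonseparating[OF assms])
qed

section \<open>Zero-dimensionality\<close>

text \<open>A connected set that meets two components contains \<open>d\<close>. Conversely, if \<open>d \<in> A\<close> then the connected set
\<open>X - A\<close> avoids \<open>d\<close>, hence lies within one component, and \<open>A\<close> contains the other two. With only
two components this would fail, which is why branch points are used rather than arbitrary cut points.\<close>

lemma branch_point_mem_iff:
  assumes A: "A \<in> nonseparating X" and "A \<subseteq> X" and d: "d \<in> X"
    and C: "U \<in> components (X - {d})" "V \<in> components (X - {d})" "W \<in> components (X - {d})"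
      "U \<noteq> V" "V \<noteq> W" "U \<noteq> W"
  shows "d \<in> A \<longleftrightarrow> A \<inter> U \<noteq> {} \<and> A \<inter> V \<noteq> {} \<or> A \<inter> V \<noteq> {} \<and> A \<inter> W \<noteq> {} \<or> A \<inter> U \<noteq> {} \<and> A \<inter> W \<noteq> {}"
proof -
  have cA: "connected A" using nonseparatingD(1)[OF A] by (simp add: subcontinua_def)
  have in1: "d \<in> A" if "P \<in> components (X - {d})" "Q \<in> components (X - {d})" "P \<noteq> Q" "A \<inter> P \<noteq> {}" "A \<inter> Q \<noteq> {}" for P Q
    using connected_crosses[OF cA \<open>A \<subseteq> X\<close> that] .
  have in2: "A \<inter> P \<noteq> {} \<or> A \<inter> Q \<noteq> {}"
    if PQ: "P \<in> components (X - {d})" "Q \<in> components (X - {d})" "P \<noteq> Q" and "d \<in> A" for P Q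
  proof (rule ccontr)
    assume "\<not> (A \<inter> P \<noteq> {} \<or> A \<inter> Q \<noteq> {})"
    then have "(X - A) \<inter> P \<noteq> {}" "(X - A) \<inter> Q \<noteq> {}"
      using in_components_nonempty[OF PQ(1)] in_components_nonempty[OF PQ(2)]
        in_components_subset[OF PQ(1)] in_components_subset[OF PQ(2)] by blast+
    then have "d \<in> X - A"
      using connected_crosses[OF nonseparatingD(2)[OF A] _ PQ] by blast
    then show False using \<open>d \<in> A\<close> by blast
  qed
  show ?thesis
    using in1[OF C(1,2,4)] in1[OF C(2,3,5)] in1[OF C(1,3,6)] in2[OF C(1,2,4)] in2[OF C(2,3,5)] in2[OF C(1,3,6)]
    by argo
qed

lemma NC_star_openI:
  assumes "openin (hyperspace X) \<U>"
  shows "openin (NC_star X) {A \<in> nonseparating X. A \<in> \<U>}"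
  using openin_subtopology_Int2[OF assms, of "nonseparating X"]
  by (simp add: NC_star_eq Int_def)

text \<open>Containing \<open>d\<close> is a closed condition, and by \<open>branch_point_mem_iff\<close> also an open one.\<close>

lemma clopen_NC_star_mem:
  assumes X: "dendrite X" and d: "branch_point X d"
  shows "openin (NC_star X) {A \<in> nonseparating X. d \<in> A}" (is ?th1)
    and "closedin (NC_star X) {A \<in> nonseparating X. d \<in> A}" (is ?th2)
proof -
  note cX = dendriteD(1)[OF X]
  obtain U V W where C: "U \<in> components (X - {d})" "V \<in> components (X - {d})" "W \<in> components (X - {d})"
      "U \<noteq> V" "V \<noteq> W" "U \<noteq> W" and dX: "d \<in> X"
    using d unfolding branch_point_def by auto
  let ?H = "\<lambda>S. {A \<in> subcontinua X. A \<inter> S \<noteq> {}}"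
  have H: "openin (hyperspace X) (?H S)" if "S \<in> components (X - {d})" for S
    by (rule openin_hyperspace_hits[OF cX component_openin[OF X that]])
  have op: "openin (hyperspace X) (?H U \<inter> ?H V \<union> ?H V \<inter> ?H W \<union> ?H U \<inter> ?H W)"
    by (intro openin_Un openin_Int H C)
  have eq: "{A \<in> nonseparating X. d \<in> A} =
      {A \<in> nonseparating X. A \<in> ?H U \<inter> ?H V \<union> ?H V \<inter> ?H W \<union> ?H U \<inter> ?H W}"
  proof (rule Collect_cong, rule conj_cong[OF refl])
    fix A assume A: "A \<in> nonseparating X"
    have "d \<in> A \<longleftrightarrow> A \<inter> U \<noteq> {} \<and> A \<inter> V \<noteq> {} \<or> A \<inter> V \<noteq> {} \<and> A \<inter> W \<noteq> {} \<or> A \<inter> U \<noteq> {} \<and> A \<inter> W \<noteq> {}"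
      using branch_point_mem_iff[OF A subcontinuaD(2)[OF cX nonseparatingD(1)[OF A]] dX C] .
    then show "d \<in> A \<longleftrightarrow> A \<in> ?H U \<inter> ?H V \<union> ?H V \<inter> ?H W \<union> ?H U \<inter> ?H W"
      using nonseparatingD(1)[OF A] by simp
  qed
  show ?th1 unfolding eq by (rule NC_star_openI[OF op])
  have "openin (NC_star X) {A \<in> nonseparating X. A \<in> {A \<in> subcontinua X. A \<subseteq> X - {d}}}"
    by (rule NC_star_openI[OF openin_hyperspace_subset[OF cX openin_Diff_singleton]])
  also have "{A \<in> nonseparating X. A \<in> {A \<in> subcontinua X. A \<subseteq> X - {d}}} =
      topspace (NC_star X) - {A \<in> nonseparating X. d \<in> A}"
    unfolding topspace_NC_star[OF cX] using nonseparatingD(1) subcontinuaD(2)[OF cX] by blast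
  finally show ?th2 unfolding closedin_def using topspace_NC_star[OF cX] by blast
qed

text \<open>A subcontinuum that is not contained in \<open>V\<close> either contains \<open>d\<close>, which is a clopen condition,
or lies in the complement of the closure of \<open>V\<close>, which is an open one.\<close>

lemma clopen_NC_star_subset:
  assumes X: "dendrite X" and d: "branch_point X d" and V: "V \<in> components (X - {d})"
  shows "openin (NC_star X) {A \<in> nonseparating X. A \<subseteq> V}" (is ?th1)
    and "closedin (NC_star X) {A \<in> nonseparating X. A \<subseteq> V}" (is ?th2)
proof -
  note cX = dendriteD(1)[OF X]
  have dX: "d \<in> X" using d by (simp add: branch_point_def)
  have clV: "closure V = insert d V" by (rule closure_cut_component[OF X dX V])
  have "openin (NC_star X) {A \<in> nonseparating X. A \<in> {A \<in> subcontinua X. A \<subseteq> V}}"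
    by (rule NC_star_openI[OF openin_hyperspace_subset[OF cX component_openin[OF X V]]])
  also have "{A \<in> nonseparating X. A \<in> {A \<in> subcontinua X. A \<subseteq> V}} = {A \<in> nonseparating X. A \<subseteq> V}"
    using nonseparatingD(1) by blast
  finally show ?th1 .
  have "open (- closure V)" by auto
  then have "openin (top_of_set X) (X - insert d V)"
    using openin_open_Int[of "- closure V" X] by (simp add: clV Diff_eq)
  then have "openin (NC_star X) {A \<in> nonseparating X. A \<in> {A \<in> subcontinua X. A \<subseteq> X - insert d V}}"
    by (rule NC_star_openI[OF openin_hyperspace_subset[OF cX]])
  then have "openin (NC_star X) ({A \<in> nonseparating X. d \<in> A} \<union>
      {A \<in> nonseparating X. A \<in> {A \<in> subcontinua X. A \<subseteq> X - insert d V}})"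
    by (rule openin_Un[OF clopen_NC_star_mem(1)[OF X d]])
  also have "{A \<in> nonseparating X. d \<in> A} \<union>
      {A \<in> nonseparating X. A \<in> {A \<in> subcontinua X. A \<subseteq> X - insert d V}} =
      topspace (NC_star X) - {A \<in> nonseparating X. A \<subseteq> V}"
  proof -
    have "(d \<in> A \<or> A \<in> {A \<in> subcontinua X. A \<subseteq> X - insert d V}) \<longleftrightarrow> \<not> A \<subseteq> V" if A: "A \<in> nonseparating X" for A
    proof -
      note a = subcontinuaD[OF cX nonseparatingD(1)[OF A]]
      have "A \<inter> V = {}" if "d \<notin> A" "\<not> A \<subseteq> V"
        using components_maximal[OF V a(6)] a(2) that by blast
      moreover have "d \<notin> V" using in_components_subset[OF V] by blast
      ultimately show ?thesis using a(1,2) nonseparatingD(1)[OF A] by blast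
    qed
    then show ?thesis unfolding topspace_NC_star[OF cX] by blast
  qed
  finally show ?th2 unfolding closedin_def using topspace_NC_star[OF cX] by blast
qed

lemma openin_neighbourhood:
  "openin (top_of_set X) {x \<in> X. \<exists>a\<in>A. dist a x < (e::real)}"
proof -
  have "{x \<in> X. \<exists>a\<in>A. dist a x < e} = X \<inter> (\<Union>a\<in>A. ball a e)" by auto
  moreover have "open (\<Union>a\<in>A. ball a e)" by auto
  ultimately show ?thesis using openin_open_Int by metis
qed

lemma openin_NC_starD:
  assumes "compact X" "openin (NC_star X) \<U>" "A \<in> \<U>"
  obtains e where "e > 0" "\<And>B. B \<in> nonseparating X \<Longrightarrow> hausdorff_dist A B < e \<Longrightarrow> B \<in> \<U>"
proof -
  obtain \<T> where T: "openin (hyperspace X) \<T>" "\<U> = \<T> \<inter> nonseparating X"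
    using assms(2) unfolding NC_star_eq openin_subtopology by blast
  then obtain e where "e > 0" "\<And>B. B \<in> subcontinua X \<Longrightarrow> hausdorff_dist A B < e \<Longrightarrow> B \<in> \<T>"
    using assms(3) openin_hyperspaceD[OF assms(1), of \<T> A] by blast
  then show thesis using that[of e] T(2) nonseparatingD(1) by blast
qed

text \<open>The clopen set \<open>\<V>\<close> keeps its members within \<open>e/2\<close> of \<open>A\<close>, and \<open>\<W>\<close> keeps \<open>A\<close> within
\<open>e/2\<close> of its members. For \<open>\<V>\<close> the members are confined to a component cut off near \<open>A\<close>; for \<open>\<W>\<close> they
are required to contain a finite \<open>e/2\<close>-net of \<open>A\<close> made of branch points.\<close>

lemma zero_dimensional_NC_star:
  assumes X: "dendrite X" and dense: "X \<subseteq> closure (endpoints X)"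
  shows "zero_dimensional (NC_star X)"
  unfolding zero_dimensional_def
proof (intro allI impI, elim conjE)
  fix \<U> A assume U: "openin (NC_star X) \<U>" "A \<in> \<U>"
  note cX = dendriteD(1)[OF X]
  let ?N = "nonseparating X"
  have A: "A \<in> ?N" using openin_subset[OF U(1)] U(2) topspace_NC_star[OF cX] by blast
  note a = subcontinuaD[OF cX nonseparatingD(1)[OF A]]
  obtain e where e: "e > 0" "\<And>B. B \<in> ?N \<Longrightarrow> hausdorff_dist A B < e \<Longrightarrow> B \<in> \<U>"
    using openin_NC_starD[OF cX U] by blast
  have top: "openin (NC_star X) ?N" "closedin (NC_star X) ?N"
    using topspace_NC_star[OF cX] by (metis openin_topspace closedin_topspace)+
  obtain \<V> where V: "openin (NC_star X) \<V>" "closedin (NC_star X) \<V>" "A \<in> \<V>"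
      "\<And>B b. B \<in> \<V> \<Longrightarrow> b \<in> B \<Longrightarrow> \<exists>a\<in>A. dist a b \<le> e/2"
  proof (cases "A = X")
    case True
    have "\<exists>a\<in>A. dist a b \<le> e/2" if "B \<in> ?N" "b \<in> B" for B b
      using that True subcontinuaD(2)[OF cX nonseparatingD(1)] e(1) by (intro bexI[of _ b]) auto
    then show thesis using that[OF top A] by blast
  next
    case False
    define Nb where "Nb = {x \<in> X. \<exists>a\<in>A. dist a x < e/2}"
    have Nb: "openin (top_of_set X) Nb" unfolding Nb_def by (rule openin_neighbourhood)
    have "A \<subseteq> Nb"
    proof
      fix x assume "x \<in> A"
      moreover have "dist x x < e/2" using e(1) by simp
      ultimately show "x \<in> Nb" unfolding Nb_def using a(2) by blast
    qed
    then obtain d V where d: "branch_point X d" "V \<in> components (X - {d})" "A \<subseteq> V" "closure V \<subseteq> Nb"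
      using branch_cut_near[OF X dense nonseparatingD[OF A] False Nb] by metis
    have "\<exists>a\<in>A. dist a b \<le> e/2" if "B \<in> {A \<in> ?N. A \<subseteq> V}" "b \<in> B" for B b
    proof -
      have "b \<in> closure V" using that closure_subset by blast
      then show ?thesis using d(4) unfolding Nb_def by force
    qed
    then show thesis using that[OF clopen_NC_star_subset[OF X d(1,2)]] A d(3) by blast
  qed
  obtain \<W> where W: "openin (NC_star X) \<W>" "closedin (NC_star X) \<W>" "A \<in> \<W>"
      "\<And>B x. B \<in> \<W> \<Longrightarrow> B \<in> \<V> \<Longrightarrow> x \<in> A \<Longrightarrow> \<exists>b\<in>B. dist x b \<le> e/2"
  \<comment> \<open>A singleton need not contain a branch point, but then the condition imposed by \<open>\<V>\<close> suffices.\<close>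
  proof (cases "\<exists>x. A = {x}")
    case True
    have "\<exists>b\<in>B. dist x b \<le> e/2" if "B \<in> ?N" "B \<in> \<V>" "x \<in> A" for B x
      using True V(4)[OF that(2)] that(3) subcontinuaD(1)[OF cX nonseparatingD(1)[OF that(1)]] by fastforce
    then show thesis using that[OF top A] by blast
  next
    case False
    define E where "E = {d \<in> A. branch_point X d}"
    have "A \<subseteq> (\<Union>d\<in>E. ball d (e/2))"
    proof
      fix x assume x: "x \<in> A"
      have "A \<noteq> {x}" using False by blast
      then obtain d where "branch_point X d" "d \<in> A" "dist x d < e/2"
        using branch_point_near[OF X dense a(6,2) x _ half_gt_zero[OF e(1)]] by metis
      then show "x \<in> (\<Union>d\<in>E. ball d (e/2))" by (auto simp: E_def dist_commute)
    qed
    then obtain F where F: "F \<subseteq> E" "finite F" "A \<subseteq> (\<Union>d\<in>F. ball d (e/2))"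
      using compactE_image[OF a(3), of E "\<lambda>d. ball d (e/2)"] by (metis open_ball)
    have "F \<noteq> {}" using F(3) a(1) by auto
    let ?W = "\<Inter>d\<in>F. {B \<in> ?N. d \<in> B}"
    have b: "branch_point X d" if "d \<in> F" for d using that F(1) by (auto simp: E_def)
    have "openin (NC_star X) ?W"
      using F(2) \<open>F \<noteq> {}\<close> clopen_NC_star_mem(1)[OF X b] by (intro openin_INT2) auto
    moreover have "closedin (NC_star X) ?W"
      using \<open>F \<noteq> {}\<close> clopen_NC_star_mem(2)[OF X b] by (intro closedin_INT) auto
    moreover have "A \<in> ?W" using A F(1) by (auto simp: E_def)
    moreover have "\<exists>b\<in>B. dist x b \<le> e/2" if "B \<in> ?W" "x \<in> A" for B x
    proof -
      obtain d where "d \<in> F" "x \<in> ball d (e/2)" using F(3) \<open>x \<in> A\<close> by blast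
      then show ?thesis using \<open>B \<in> ?W\<close> by (intro bexI[of _ d]) (auto simp: dist_commute)
    qed
    ultimately show thesis using that[of ?W] by simp
  qed
  have "\<V> \<inter> \<W> \<subseteq> \<U>"
  proof
    fix B assume B: "B \<in> \<V> \<inter> \<W>"
    then have BN: "B \<in> ?N" using openin_subset[OF V(1)] topspace_NC_star[OF cX] by blast
    note b = subcontinuaD[OF cX nonseparatingD(1)[OF BN]]
    have "hausdorff_dist A B \<le> e/2"
    proof (rule hausdorff_dist_le[OF a(1) b(1) a(5) b(5)])
      show "\<exists>b\<in>B. dist x b \<le> e/2" if "x \<in> A" for x using W(4) B that by blast
      show "\<exists>x\<in>A. dist x b \<le> e/2" if "b \<in> B" for b using V(4) B that by blast
    qed
    then show "B \<in> \<U>" using e BN by simp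
  qed
  then show "\<exists>V. openin (NC_star X) V \<and> closedin (NC_star X) V \<and> A \<in> V \<and> V \<subseteq> \<U>"
    using V(1-3) W(1-3) by (intro exI[of _ "\<V> \<inter> \<W>"]) (auto intro: openin_Int closedin_Int)
qed

section \<open>Absence of compact open sets\<close>

lemma component_complement_nonseparating:
  assumes X: "dendrite X" and p: "p \<in> X" and W: "W \<in> components (X - {p})"
  shows "X - W \<in> nonseparating X"
proof -
  have "connected (X - W)"
    using component_diff_connected[OF connected_sing dendriteD(2)[OF X] _ W] p by simp
  moreover have "p \<in> X - W" using p in_components_subset[OF W] by blast
  moreover have "closedin (top_of_set X) (X - W)"
    using component_openin[OF X W] by (simp add: closedin_diff)
  moreover have "X - (X - W) = W" using in_components_subset[OF W] by blast
  ultimately show ?thesis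
    using in_components_connected[OF W] by (auto simp: nonseparating_def subcontinua_def)
qed

text \<open>The set \<open>X - V\<close> is itself nonseparating. Cutting it off by a branch point \<open>p\<close> near \<open>d\<close>, inside the
neighbourhood \<open>(X - V) \<union> ball d (e/3)\<close>, leaves the nonseparating set \<open>X - W\<close>, which exhausts \<open>V\<close> up to that
ball and reaches into the ball at \<open>p\<close>.\<close>

lemma closure_component_limit:
  assumes X: "dendrite X" and dense: "X \<subseteq> closure (endpoints X)"
    and d: "d \<in> X" and V: "V \<in> components (X - {d})" and e: "e > 0"
  obtains B where "B \<in> nonseparating X" "hausdorff_dist (closure V) B < e"
proof -
  note cX = dendriteD(1)[OF X]
  have clV: "closure V = insert d V" by (rule closure_cut_component[OF X d V])
  have VX: "V \<subseteq> X - {d}" "V \<noteq> {}" using in_components_subset[OF V] in_components_nonempty[OF V] by auto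
  have R: "X - V \<in> nonseparating X" by (rule component_complement_nonseparating[OF X d V])
  define U where "U = (X - V) \<union> (X \<inter> ball d (e/3))"
  have "U = X \<inter> (- closure V \<union> ball d (e/3))" using e by (auto simp: U_def clV)
  then have "openin (top_of_set X) U" by (metis open_Un open_ball open_Compl closed_closure openin_open_Int)
  moreover have "X - V \<subseteq> U" "X - V \<noteq> X" using VX by (auto simp: U_def)
  ultimately obtain p W where p: "branch_point X p" "W \<in> components (X - {p})" "X - V \<subseteq> W" "closure W \<subseteq> U"
    using branch_cut_near[OF X dense nonseparatingD[OF R]] by metis
  have pX: "p \<in> X" using p(1) by (simp add: branch_point_def)
  have pW: "p \<in> closure W" "p \<notin> W"
    using closure_cut_component[OF X pX p(2)] in_components_subset[OF p(2)] by auto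
  then have pd: "dist d p < e/3" using p(3,4) pX by (auto simp: U_def)
  have B: "X - W \<in> nonseparating X" by (rule component_complement_nonseparating[OF X pX p(2)])
  note b = subcontinuaD[OF cX nonseparatingD(1)[OF B]]
  have "hausdorff_dist (closure V) (X - W) \<le> 2 * (e/3)"
  proof (rule hausdorff_dist_le)
    show "closure V \<noteq> {}" using clV by simp
    have "closure V \<subseteq> X" using clV d VX(1) by auto
    then show "bounded (closure V)" using compact_imp_bounded[OF cX] bounded_subset by blast
    show "\<exists>b\<in>X - W. dist x b \<le> 2 * (e/3)" if x: "x \<in> closure V" for x
    proof (cases "x \<in> W")
      case True
      then have "x \<in> U" using p(4) closure_subset by blast
      then have "dist d x < e/3" using x clV e by (auto simp: U_def)
      then have "dist x p \<le> 2 * (e/3)" using pd dist_triangle3[of x p d] by linarith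
      then show ?thesis using pX pW(2) by blast
    next
      case False
      then show ?thesis using x \<open>closure V \<subseteq> X\<close> e by (intro bexI[of _ x]) auto
    qed
    show "\<exists>x\<in>closure V. dist x b \<le> 2 * (e/3)" if "b \<in> X - W" for b
      using that p(3) clV e by (intro bexI[of _ b]) auto
  qed (use b in auto)
  then have "hausdorff_dist (closure V) (X - W) < e" using e by simp
  then show thesis using that B by blast
qed

text \<open>At least two components of \<open>X - {d}\<close> lie outside the closure of \<open>V\<close>, and only \<open>d\<close> could connect them.\<close>

lemma closure_component_separates:
  assumes X: "dendrite X" and d: "branch_point X d" and V: "V \<in> components (X - {d})"
  shows "closure V \<in> subcontinua X" "closure V \<notin> nonseparating X"
proof -
  have dX: "d \<in> X" using d by (simp add: branch_point_def)
  have clV: "closure V = insert d V" by (rule closure_cut_component[OF X dX V])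
  have VX: "V \<subseteq> X - {d}" using in_components_subset[OF V] .
  show "closure V \<in> subcontinua X"
  proof (rule subcontinuaI)
    show "closure V \<subseteq> X" "closure V \<noteq> {}" using clV VX dX by auto
    show "connected (closure V)"
      by (rule connected_imp_connected_closure[OF in_components_connected[OF V]])
  qed simp
  obtain P Q where PQ: "P \<in> components (X - {d})" "Q \<in> components (X - {d})" "P \<noteq> Q" "P \<noteq> V" "Q \<noteq> V"
    using d unfolding branch_point_def by (metis insert_subset)
  have "(X - closure V) \<inter> R \<noteq> {}" if R: "R \<in> components (X - {d})" "R \<noteq> V" for R
  proof -
    obtain x where "x \<in> R" using in_components_nonempty[OF R(1)] by blast
    moreover have "R \<inter> V = {}" using components_nonoverlap[OF R(1) V] R(2) by simp
    moreover have "R \<subseteq> X - {d}" using in_components_subset[OF R(1)] .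
    ultimately have "x \<in> (X - closure V) \<inter> R" unfolding clV by blast
    then show ?thesis by blast
  qed
  then have "(X - closure V) \<inter> P \<noteq> {}" "(X - closure V) \<inter> Q \<noteq> {}" using PQ by simp_all
  then have "\<not> connected (X - closure V)"
    using connected_crosses[OF _ Diff_subset PQ(1-3)] clV by blast
  then show "closure V \<notin> nonseparating X" by (simp add: nonseparating_def)
qed

text \<open>Remove a small component cut off near an endpoint.\<close>

lemma proper_nonseparating_near_whole:
  assumes X: "dendrite X" and dense: "X \<subseteq> closure (endpoints X)" and e: "e > 0"
  obtains B where "B \<in> nonseparating X" "B \<noteq> X" "hausdorff_dist X B < e"
proof -
  note cX = dendriteD(1)[OF X]
  obtain x y where two: "x \<in> X" "y \<in> X" "x \<noteq> y"
    using X unfolding dendrite_def dendroid_def continuum_def by (elim conjE bexE)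
  then have "endpoints X \<noteq> {}" using dense by auto
  then obtain z where z: "z \<in> endpoints X" by blast
  then have zX: "z \<in> X" by (simp add: endpoints_def)
  have "{z} \<in> subcontinua X" using zX by (intro subcontinuaI) auto
  moreover have "{z} \<noteq> X" using two by blast
  moreover have "openin (top_of_set X) (X \<inter> ball z (e/3))" "{z} \<subseteq> X \<inter> ball z (e/3)"
    using zX e by (auto intro: openin_open_Int)
  ultimately obtain p W where p: "branch_point X p" "W \<in> components (X - {p})" "{z} \<subseteq> W" "closure W \<subseteq> X \<inter> ball z (e/3)"
    using branch_cut_near[OF X dense _ endpoint_connected_Diff[OF X z]] by metis
  have pX: "p \<in> X" using p(1) by (simp add: branch_point_def)
  have pW: "p \<in> closure W" "p \<notin> W"
    using closure_cut_component[OF X pX p(2)] in_components_subset[OF p(2)] by auto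
  then have pz: "dist z p < e/3" using p(4) by auto
  have B: "X - W \<in> nonseparating X" by (rule component_complement_nonseparating[OF X pX p(2)])
  note b = subcontinuaD[OF cX nonseparatingD(1)[OF B]]
  have "hausdorff_dist X (X - W) \<le> 2 * (e/3)"
  proof (rule hausdorff_dist_le)
    show "\<exists>b\<in>X - W. dist x b \<le> 2 * (e/3)" if x: "x \<in> X" for x
    proof (cases "x \<in> W")
      case True
      then have "dist z x < e/3" using p(4) closure_subset by fastforce
      then have "dist x p \<le> 2 * (e/3)" using pz dist_triangle3[of x p z] by linarith
      then show ?thesis using pX pW(2) by blast
    next
      case False
      then show ?thesis using x e by (intro bexI[of _ x]) auto
    qed
    show "\<exists>x\<in>X. dist x b \<le> 2 * (e/3)" if "b \<in> X - W" for b
      using that e by (intro bexI[of _ b]) auto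
  qed (use b zX compact_imp_bounded[OF cX] in auto)
  then have "hausdorff_dist X (X - W) < e" using e by simp
  moreover have "X - W \<noteq> X" using p(3) zX by blast
  ultimately show thesis using that B by blast
qed

text \<open>A compact \<open>\<U>\<close> would be closed in the hyperspace. For \<open>A \<in> \<U>\<close> different from \<open>X\<close> there is a component \<open>V\<close> as in
\<open>branch_cut_near\<close> whose closure is close to \<open>A\<close>; it is a limit of members of \<open>\<U>\<close> but does not belong
to \<open>\<U>\<close>.\<close>

lemma not_compactin_open_NC_star:
  assumes X: "dendrite X" and dense: "X \<subseteq> closure (endpoints X)"
    and U: "openin (NC_star X) \<U>" "\<U> \<noteq> {}"
  shows "\<not> compactin (NC_star X) \<U>"
proof
  assume comp: "compactin (NC_star X) \<U>"
  note cX = dendriteD(1)[OF X]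
  interpret Metric_space "subcontinua X" hausdorff_dist
    by (rule Metric_space_hausdorff_dist[OF cX])
  have UN: "\<U> \<subseteq> nonseparating X" using openin_subset[OF U(1)] topspace_NC_star[OF cX] by simp
  have "compactin (hyperspace X) \<U>" using comp by (simp add: NC_star_eq compactin_subtopology)
  then have "closedin (hyperspace X) \<U>"
    unfolding hyperspace_def by (rule compactin_imp_closedin[OF Hausdorff_space_mtopology])
  then have co: "openin (hyperspace X) (subcontinua X - \<U>)"
    using topspace_hyperspace[OF cX] by (metis closedin_def)
  obtain A where A: "A \<in> \<U>" "A \<noteq> X"
  proof -
    obtain A where A: "A \<in> \<U>" using U(2) by blast
    show thesis
    proof (cases "A = X")
      case True
      obtain e where "e > 0" "\<And>B. B \<in> nonseparating X \<Longrightarrow> hausdorff_dist A B < e \<Longrightarrow> B \<in> \<U>"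
        using openin_NC_starD[OF cX U(1) A] by metis
      moreover obtain B where "B \<in> nonseparating X" "B \<noteq> X" "hausdorff_dist X B < e"
        using proper_nonseparating_near_whole[OF X dense \<open>e > 0\<close>] by metis
      ultimately show thesis using that True by blast
    qed (use A that in blast)
  qed
  have AN: "A \<in> nonseparating X" using A(1) UN by blast
  note a = subcontinuaD[OF cX nonseparatingD(1)[OF AN]]
  obtain e where e: "e > 0" "\<And>B. B \<in> nonseparating X \<Longrightarrow> hausdorff_dist A B < e \<Longrightarrow> B \<in> \<U>"
    using openin_NC_starD[OF cX U(1) A(1)] by metis
  define Nb where "Nb = {x \<in> X. \<exists>a\<in>A. dist a x < e/2}"
  have Nb: "openin (top_of_set X) Nb" unfolding Nb_def by (rule openin_neighbourhood)
  have "A \<subseteq> Nb"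
  proof
    fix x assume "x \<in> A"
    moreover have "dist x x < e/2" using e(1) by simp
    ultimately show "x \<in> Nb" unfolding Nb_def using a(2) by blast
  qed
  then obtain d V where d: "branch_point X d" "V \<in> components (X - {d})" "A \<subseteq> V" "closure V \<subseteq> Nb"
    using branch_cut_near[OF X dense nonseparatingD[OF AN] A(2) Nb] by metis
  have L: "closure V \<in> subcontinua X" "closure V \<notin> nonseparating X"
    by (rule closure_component_separates[OF X d(1,2)])+
  note l = subcontinuaD[OF cX L(1)]
  have AL: "hausdorff_dist A (closure V) \<le> e/2"
  proof (rule hausdorff_dist_le[OF a(1) l(1) a(5) l(5)])
    show "\<exists>b\<in>closure V. dist x b \<le> e/2" if "x \<in> A" for x
      using that d(3) closure_subset e(1) by (intro bexI[of _ x]) auto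
    show "\<exists>x\<in>A. dist x b \<le> e/2" if "b \<in> closure V" for b
      using that d(4) unfolding Nb_def by force
  qed
  have "closure V \<in> subcontinua X - \<U>" using L UN by blast
  then obtain \<delta> where \<delta>: "\<delta> > 0"
      "\<And>B. B \<in> subcontinua X \<Longrightarrow> hausdorff_dist (closure V) B < \<delta> \<Longrightarrow> B \<in> subcontinua X - \<U>"
    using openin_hyperspaceD[OF cX co] by metis
  have "min \<delta> (e/2) > 0" using \<delta>(1) e(1) by simp
  moreover have "d \<in> X" using d(1) by (simp add: branch_point_def)
  ultimately obtain B where B: "B \<in> nonseparating X" "hausdorff_dist (closure V) B < min \<delta> (e/2)"
    using closure_component_limit[OF X dense _ d(2)] by metis
  have "hausdorff_dist A B < e"
    using triangle[OF nonseparatingD(1)[OF AN] L(1) nonseparatingD(1)[OF B(1)]] AL B(2) by simp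
  then have "B \<in> \<U>" using e(2) B(1) by blast
  then show False using \<delta>(2)[OF nonseparatingD(1)[OF B(1)]] B(2) by simp
qed

section \<open>The homeomorphism\<close>

theorem theorem5p7:
  fixes X :: "'a::metric_space set"
  assumes "dendrite X"
    and "X \<subseteq> closure (endpoints X)"
  shows "NC_star X homeomorphic_space top_of_set (UNIV - \<rat> :: real set)"
proof (rule Alexandroff_Urysohn)
  note X = dendriteD[OF assms(1)]
  show "completely_metrizable_space (NC_star X)" by (rule completely_metrizable_NC_star[OF X(1,3)])
  show "second_countable (NC_star X)"
    unfolding NC_star_eq by (intro second_countable_subtopology second_countable_hyperspace X(1))
  show "zero_dimensional (NC_star X)" by (rule zero_dimensional_NC_star[OF assms])
  have "X \<noteq> {}" using assms(1) by (auto simp: dendrite_def dendroid_def continuum_def)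
  then have "X \<in> nonseparating X"
    using X(1,2) by (auto simp: nonseparating_def intro!: subcontinuaI compact_imp_closed)
  then show "topspace (NC_star X) \<noteq> {}" using topspace_NC_star[OF X(1)] by blast
  show "\<not> compactin (NC_star X) U" if "openin (NC_star X) U" "U \<noteq> {}" for U
    by (rule not_compactin_open_NC_star[OF assms that])
  obtain c :: real where "c \<notin> \<rat>" using irrational_between[of 0 1] by auto
  then show "topspace irrationals \<noteq> {}" by auto
qed (use completely_metrizable_irrationals second_countable_irrationals zero_dimensional_irrationals
    not_compactin_open_irrationals in auto)

end
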